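(* Let $D=[0,1]$, let $\mu_0$ be a prior on $C([0,1],\mathbb{R})$, let $(x_i)_{i\in\mathbb{N}}\subset[0,1]$, and consider the regression model $y_i=a(x_i)+\xi_i$, $i=1,\dots,n$, with $\xi_i$ i.i.d. $\mathcal{N}(0,\sigma^2)$, with posterior $\mu^{y_{1:n}}$ for data $y_i=a^\dagger(x_i)+\xi_i$. Suppose that (i) there exist $\beta\in(0,1]$ and $L>0$ such that $\|a\|_\beta\le L$ and $\|a\|_\infty\le L$ for $\mu_0$-a.e. $a$; (ii) there exists $K>0$ such that for any $a<b$ in $[0,1]$ there is an $N(a,b)$ with $F_n(b)-F_n(a)\ge K(b-a)$ for all $n>N(a,b)$, where $F_n$ denotes the empirical distribution function of $\{x_i\}_{i=1}^n$. Then $\mu^{y_{1:n}}$ is posterior consistent with respect to the $L^\infty$-norm for any $a^\dagger\in\operatorname{supp}_{C^\beta}(\mu_0)$. Moreover, if in addition (iii) there exists a constant $K$ such that for every $n$, whenever $0<a<b<1$ and $b-a\ge\frac1{Kn}$, there is at least one $i\in\{1,\dots,n\}$ with $x_i\in(a,b)$, and (iv) for some $\rho>0$, $\log\mu_0\big(B^{L^\infty}_\epsilon(a^\dagger)\big)\gtrsim-\epsilon^{-\rho}$, then $\mu^{y_{1:n}}$ is posterior consistent for $a^\dagger$ with respect to the $L^\infty$-norm with rate $n^{-\kappa}$ for any $$\kappa<\min\Big\{\frac{1}{2(2+\frac1\beta)},\frac{2\beta}{(2\beta+1)(2+\rho)}\Big\}.$$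
   Context: $\|a\|_\beta=\sup_{x\ne y}|a(x)-a(y)|/|x-y|^\beta$ is the Hölder (semi)norm of order $\beta$ on $[0,1]$. The posterior is $$\frac{d\mu^{y_{1:n}}}{d\mu_0}(a)\propto\exp\Big(-\sum_{i=1}^n\frac{(a(x_i)-y_i)^2}{2\sigma^2}\Big).$$ Posterior consistency for $a^\dagger$ with respect to a norm with rate $\epsilon_n\downarrow0$: there exist a constant $M$ and $l_n\to1$ with $\mathbb{P}_{\xi}\big(\mu^{y_{1:n}}(B_{M\epsilon_n}(a^\dagger))\ge l_n\big)\to1$, where the data are $y_i=a^\dagger(x_i)+\xi_i$ and balls are taken in the given norm. "Posterior consistent" without a rate means this holds with $\epsilon_n=\epsilon$ for every fixed constant $\epsilon>0$ (i.e. for each radius $\epsilon>0$). $\operatorname{supp}_d(\mu)=\{x:\mu(B^d_\epsilon(x))>0\ \forall\epsilon>0\}$; $\operatorname{supp}_{C^\beta}$ uses the metric of the Hölder space $C^\beta([0,1])$. The notation $\log\mu_0(B_\epsilon)\gtrsim-\epsilon^{-\rho}$ means there are $C,\epsilon_0>0$ with $\log\mu_0(B_\epsilon)\ge-C\epsilon^{-\rho}$ for $0<\epsilon\le\epsilon_0$. *)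

theory Defs
  imports "HOL-Probability.Probability"
begin

text \<open>
  The domain \<open>[0,1]\<close> as a type, so that \<open>C([0,1])\<close> with the \<open>L\<^sup>\<infinity>\<close>-norm and its Borel
  sigma-algebra is the library space of bounded continuous functions.
\<close>

typedef unit_interval = "{0..1::real}"
  morphisms of_unit to_unit
  by (rule exI[of _ 0]) simp

instantiation unit_interval :: metric_space
begin

definition dist_unit_interval :: "unit_interval \<Rightarrow> unit_interval \<Rightarrow> real" where
  "dist_unit_interval s t = \<bar>of_unit s - of_unit t\<bar>"

definition uniformity_unit_interval :: "(unit_interval \<times> unit_interval) filter" where
  "uniformity_unit_interval = (INF e\<in>{0<..}. principal {(s, t). dist s t < e})"

definition open_unit_interval :: "unit_interval set \<Rightarrow> bool" where
  "open_unit_interval U \<longleftrightarrow> (\<forall>t\<in>U. eventually (\<lambda>(t', s). t' = t \<longrightarrow> s \<in> U) uniformity)"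

instance
  by standard
    (auto simp: dist_unit_interval_def uniformity_unit_interval_def open_unit_interval_def
      of_unit_inject)

end

type_synonym C01 = "(unit_interval, real) bcontfun"

lemma continuous_on_to_unit: "continuous_on {0..1} to_unit"
  unfolding continuous_on_iff
  by (auto simp: dist_unit_interval_def dist_real_def to_unit_inverse)

lemma compact_UNIV_unit_interval: "compact (UNIV :: unit_interval set)"
proof -
  have "(UNIV :: unit_interval set) = to_unit ` {0..1}"
    using of_unit of_unit_inverse by (metis UNIV_eq_I image_eqI)
  then show ?thesis
    using compact_continuous_image[OF continuous_on_to_unit] by simp
qed

text \<open>By compactness, boundedness is no restriction: \<open>C01\<close> contains every continuous function.\<close>

lemma bcontfun_unit_interval:
  fixes f :: "unit_interval \<Rightarrow> real"
  shows "f \<in> bcontfun \<longleftrightarrow> continuous_on UNIV f"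
  using compact_continuous_image[OF _ compact_UNIV_unit_interval, of f]
  by (auto simp: bcontfun_def intro: compact_imp_bounded)

text \<open>The value is \<open>\<infinity>\<close> for functions that are not \<open>\<beta>\<close>-Hoelder.\<close>

definition holder_seminorm :: "real \<Rightarrow> C01 \<Rightarrow> ennreal" where
  "holder_seminorm \<beta> a =
     (SUP (s, t)\<in>{(s, t). s \<noteq> t}.
        ennreal (\<bar>apply_bcontfun a s - apply_bcontfun a t\<bar> / dist s t powr \<beta>))"

definition holder_space :: "real \<Rightarrow> C01 set" where
  "holder_space \<beta> = {a. holder_seminorm \<beta> a < \<infinity>}"

definition holder_dist :: "real \<Rightarrow> C01 \<Rightarrow> C01 \<Rightarrow> real" where
  "holder_dist \<beta> a b = norm (a - b) + enn2real (holder_seminorm \<beta> (a - b))"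

definition metric_support :: "'a set \<Rightarrow> ('a \<Rightarrow> 'a \<Rightarrow> real) \<Rightarrow> 'a measure \<Rightarrow> 'a set" where
  "metric_support S d \<mu> = {x \<in> S. \<forall>\<epsilon>>0. emeasure \<mu> {z \<in> S. d x z < \<epsilon>} > 0}"

definition holder_support :: "real \<Rightarrow> C01 measure \<Rightarrow> C01 set" where
  "holder_support \<beta> \<mu> = metric_support (holder_space \<beta>) (holder_dist \<beta>) \<mu>"

text \<open>
  Design points, observations and noise are indexed by \<open>1, 2, \<dots>\<close>; the value of these
  sequences at index \<open>0\<close> is never used.
\<close>

definition empirical_cdf :: "(nat \<Rightarrow> unit_interval) \<Rightarrow> nat \<Rightarrow> real \<Rightarrow> real" where
  "empirical_cdf x n t = real (card {i \<in> {1..n}. of_unit (x i) \<le> t}) / real n"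

definition likelihood ::
    "(nat \<Rightarrow> unit_interval) \<Rightarrow> real \<Rightarrow> nat \<Rightarrow> (nat \<Rightarrow> real) \<Rightarrow> C01 \<Rightarrow> real" where
  "likelihood x \<sigma> n y a =
     exp (- (\<Sum>i=1..n. (apply_bcontfun a (x i) - y i)\<^sup>2 / (2 * \<sigma>\<^sup>2)))"

definition posterior ::
    "C01 measure \<Rightarrow> (nat \<Rightarrow> unit_interval) \<Rightarrow> real \<Rightarrow> nat \<Rightarrow> (nat \<Rightarrow> real) \<Rightarrow> C01 measure" where
  "posterior \<mu>\<^sub>0 x \<sigma> n y =
     density \<mu>\<^sub>0 (\<lambda>a. ennreal (likelihood x \<sigma> n y a / (\<integral>b. likelihood x \<sigma> n y b \<partial>\<mu>\<^sub>0)))"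

definition iid_gaussian_noise :: "'w measure \<Rightarrow> (nat \<Rightarrow> 'w \<Rightarrow> real) \<Rightarrow> real \<Rightarrow> bool" where
  "iid_gaussian_noise P \<xi> \<sigma> \<longleftrightarrow>
     prob_space P \<and>
     prob_space.indep_vars P (\<lambda>_. borel) \<xi> {1..} \<and>
     (\<forall>i\<ge>1. distributed P lborel (\<xi> i) (normal_density 0 \<sigma>))"

text \<open>Balls are those of the \<open>L\<^sup>\<infinity>\<close>-norm, i.e. of the metric of \<open>C01\<close>.\<close>

definition posterior_concentrates ::
    "C01 measure \<Rightarrow> (nat \<Rightarrow> unit_interval) \<Rightarrow> real \<Rightarrow> 'w measure \<Rightarrow> (nat \<Rightarrow> 'w \<Rightarrow> real) \<Rightarrow>
     C01 \<Rightarrow> (nat \<Rightarrow> real) \<Rightarrow> bool" where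
  "posterior_concentrates \<mu>\<^sub>0 x \<sigma> P \<xi> a\<^sub>0 r \<longleftrightarrow>
     (\<exists>l. l \<longlonglongrightarrow> 1 \<and>
       (\<lambda>n. measure P {\<omega> \<in> space P.
          measure (posterior \<mu>\<^sub>0 x \<sigma> n (\<lambda>i. apply_bcontfun a\<^sub>0 (x i) + \<xi> i \<omega>)) (ball a\<^sub>0 (r n))
            \<ge> l n}) \<longlonglongrightarrow> 1)"

definition posterior_consistent_with_rate ::
    "C01 measure \<Rightarrow> (nat \<Rightarrow> unit_interval) \<Rightarrow> real \<Rightarrow> 'w measure \<Rightarrow> (nat \<Rightarrow> 'w \<Rightarrow> real) \<Rightarrow>
     C01 \<Rightarrow> (nat \<Rightarrow> real) \<Rightarrow> bool" where
  "posterior_consistent_with_rate \<mu>\<^sub>0 x \<sigma> P \<xi> a\<^sub>0 \<epsilon> \<longleftrightarrow>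
     (\<exists>M. posterior_concentrates \<mu>\<^sub>0 x \<sigma> P \<xi> a\<^sub>0 (\<lambda>n. M * \<epsilon> n))"

text \<open>
  Every radius \<open>\<epsilon>\<close> has to be reached: there is no constant \<open>M\<close> here, since an \<open>M\<close> depending
  on \<open>\<epsilon>\<close> would make the notion void for bounded priors.
\<close>

definition posterior_consistent ::
    "C01 measure \<Rightarrow> (nat \<Rightarrow> unit_interval) \<Rightarrow> real \<Rightarrow> 'w measure \<Rightarrow> (nat \<Rightarrow> 'w \<Rightarrow> real) \<Rightarrow>
     C01 \<Rightarrow> bool" where
  "posterior_consistent \<mu>\<^sub>0 x \<sigma> P \<xi> a\<^sub>0 \<longleftrightarrow>
     (\<forall>\<epsilon>>0. posterior_concentrates \<mu>\<^sub>0 x \<sigma> P \<xi> a\<^sub>0 (\<lambda>n. \<epsilon>))"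

text \<open>Positivity of the mass is stated separately because \<open>ln 0 = 0\<close>.\<close>

definition small_ball_condition :: "C01 measure \<Rightarrow> C01 \<Rightarrow> real \<Rightarrow> bool" where
  "small_ball_condition \<mu>\<^sub>0 a\<^sub>0 \<rho> \<longleftrightarrow>
     (\<exists>C>0. \<exists>\<epsilon>\<^sub>0>0. \<forall>\<epsilon>. 0 < \<epsilon> \<and> \<epsilon> \<le> \<epsilon>\<^sub>0 \<longrightarrow>
        measure \<mu>\<^sub>0 (ball a\<^sub>0 \<epsilon>) > 0 \<and> ln (measure \<mu>\<^sub>0 (ball a\<^sub>0 \<epsilon>)) \<ge> - C * \<epsilon> powr (-\<rho>))"

end

theory Submission
  imports Defs "HOL-Real_Asymp.Real_Asymp"
begin

text \<open>
  The posterior mass of \<open>{a. norm (a - a\<^sub>0) > \<epsilon>}\<close> is controlled by local averages instead of entropy.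
  On a mesh of width of order \<open>\<epsilon> powr (1 / \<beta>)\<close>, a Hoelder function \<open>a - a\<^sub>0\<close> whose norm exceeds \<open>\<epsilon>\<close>
  is \<open>\<ge> \<epsilon> / 2\<close> or \<open>\<le> - \<epsilon> / 2\<close> on a whole cell. Thresholding the mean residual at \<open>\<epsilon> / 4\<close> on a cell with
  \<open>N\<close> design points detects this with both error probabilities at most \<open>exp (- N \<epsilon>\<^sup>2 / (32 \<sigma>\<^sup>2))\<close>, and the
  union bound only costs the number of cells. The evidence is bounded below by the prior mass of
  a small ball around \<open>a\<^sub>0\<close>. Every random quantity involved is an exponential of an affine function of
  the noise, so that Gaussian moment generating functions, Tonelli and a single application of
  Markov's inequality suffice.

  Since \<open>N\<close> is of order \<open>n \<epsilon> powr (1 / \<beta>)\<close>, the rate is limited only by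
  \<open>n \<epsilon> powr (2 + 1 / \<beta>) \<gg> n powr (\<rho> / (2 + \<rho>))\<close>,
  the right-hand side being the order of the log evidence; solving for \<open>\<epsilon>\<close> gives the second term of
  the minimum.
\<close>

section \<open>Gaussian moments, an integral lower bound and Borel evaluation maps\<close>

text \<open>Completing the square: the factor \<open>exp (c * y)\<close> moves the mean of the
  density to \<open>\<sigma>\<^sup>2 * c\<close> and leaves a constant, and the shifted density has
  total mass one.\<close>

lemma nn_integral_exp_normal_density:
  assumes "\<sigma> > 0"
  shows "(\<integral>\<^sup>+y. ennreal (normal_density 0 \<sigma> y) * ennreal (exp (c * y)) \<partial>lborel)
    = ennreal (exp (\<sigma>\<^sup>2 * c\<^sup>2 / 2))"
proof -
  have eq: "normal_density 0 \<sigma> y * exp (c * y) =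
      exp (\<sigma>\<^sup>2 * c\<^sup>2 / 2) * normal_density (\<sigma>\<^sup>2 * c) \<sigma> y" for y
  proof -
    have "- (y - 0)\<^sup>2 / (2 * \<sigma>\<^sup>2) + c * y = \<sigma>\<^sup>2 * c\<^sup>2 / 2 + - (y - \<sigma>\<^sup>2 * c)\<^sup>2 / (2 * \<sigma>\<^sup>2)"
      using assms by (simp add: field_simps power2_eq_square)
    then show ?thesis
      unfolding normal_density_def by (simp add: mult_exp_exp)
  qed
  have "(\<integral>\<^sup>+y. ennreal (normal_density 0 \<sigma> y) * ennreal (exp (c * y)) \<partial>lborel)
      = (\<integral>\<^sup>+y. ennreal (exp (\<sigma>\<^sup>2 * c\<^sup>2 / 2)) * ennreal (normal_density (\<sigma>\<^sup>2 * c) \<sigma> y) \<partial>lborel)"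
    by (simp add: ennreal_mult[symmetric] eq)
  also have "\<dots> = ennreal (exp (\<sigma>\<^sup>2 * c\<^sup>2 / 2)) * (\<integral>\<^sup>+y. ennreal (normal_density (\<sigma>\<^sup>2 * c) \<sigma> y) \<partial>lborel)"
    by (rule nn_integral_cmult) simp
  also have "(\<integral>\<^sup>+y. ennreal (normal_density (\<sigma>\<^sup>2 * c) \<sigma> y) \<partial>lborel) = 1"
    using assms by (subst nn_integral_eq_integral) auto
  finally show ?thesis by simp
qed

text \<open>Integrating the AM-GM bound \<open>2 c \<le> f + c\<^sup>2 / f\<close> over \<open>B\<close> replaces Jensen's inequality
  in the lower bound for the evidence.\<close>

lemma nn_integral_ge_of_inverse_le:
  fixes f :: "'a \<Rightarrow> real"
  assumes f[measurable]: "f \<in> borel_measurable M" and pos: "\<And>x. f x > 0"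
    and B[measurable]: "B \<in> sets M" and p: "emeasure M B = ennreal p" "p \<ge> 0" and c: "c > 0"
    and le: "(\<integral>\<^sup>+x. indicator B x * ennreal (1 / f x) \<partial>M) \<le> ennreal (p / c)"
  shows "ennreal (c * p) \<le> (\<integral>\<^sup>+x. indicator B x * ennreal (f x) \<partial>M)"
proof -
  let ?I = "\<integral>\<^sup>+x. indicator B x * ennreal (f x) \<partial>M"
  have amgm: "2 * c \<le> f x + c\<^sup>2 * (1 / f x)" for x
  proof -
    have "0 \<le> (f x - c)\<^sup>2 / f x" using pos[of x] by simp
    also have "\<dots> = f x + c\<^sup>2 * (1 / f x) - 2 * c"
      using pos[of x] by (simp add: field_simps power2_eq_square)
    finally show ?thesis by simp
  qed
  have "ennreal (2 * c * p) = (\<integral>\<^sup>+x. ennreal (2 * c) * indicator B x \<partial>M)"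
    using c p by (simp add: nn_integral_cmult ennreal_mult)
  also have "\<dots> \<le> (\<integral>\<^sup>+x. indicator B x * ennreal (f x)
      + ennreal (c\<^sup>2) * (indicator B x * ennreal (1 / f x)) \<partial>M)"
  proof (rule nn_integral_mono)
    fix x
    have "ennreal (2 * c) \<le> ennreal (f x) + ennreal (c\<^sup>2) * ennreal (1 / f x)"
      using amgm[of x] pos[of x] by (simp add: ennreal_mult[symmetric] ennreal_plus[symmetric] less_imp_le ennreal_leI del: ennreal_plus)
    then show "ennreal (2 * c) * indicator B x \<le> indicator B x * ennreal (f x)
      + ennreal (c\<^sup>2) * (indicator B x * ennreal (1 / f x))"
      by (cases "x \<in> B") auto
  qed
  also have "\<dots> = ?I + ennreal (c\<^sup>2) * (\<integral>\<^sup>+x. indicator B x * ennreal (1 / f x) \<partial>M)"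
    by (simp add: nn_integral_add nn_integral_cmult)
  also have "\<dots> \<le> ?I + ennreal (c\<^sup>2) * ennreal (p / c)"
    by (intro add_left_mono mult_left_mono le) auto
  also have "ennreal (c\<^sup>2) * ennreal (p / c) = ennreal (c * p)"
    using c p by (simp add: ennreal_mult[symmetric] power2_eq_square)
  finally have "ennreal (2 * c * p) \<le> ?I + ennreal (c * p)" .
  moreover have "ennreal (2 * c * p) = ennreal (c * p) + ennreal (c * p)"
    using c p by (simp add: ennreal_plus[symmetric] del: ennreal_plus)
  \<comment> \<open>Only a finite term can be cancelled in \<open>ennreal\<close>;
    \<open>c * p\<close> is one.\<close>
  ultimately have "ennreal (c * p) + ennreal (c * p) \<le> ennreal (c * p) + ?I"
    by (simp only: add.commute)
  then show ?thesis
    unfolding ennreal_add_left_cancel_le by simp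
qed

text \<open>Evaluation at a point is 1-Lipschitz for the sup norm, hence continuous and
  Borel.\<close>

lemma borel_measurable_apply_bcontfun[measurable]:
  "(\<lambda>a :: ('a :: topological_space, real) bcontfun. apply_bcontfun a t) \<in> borel_measurable borel"
proof (rule borel_measurable_continuous_onI)
  show "continuous_on UNIV (\<lambda>a :: ('a, real) bcontfun. apply_bcontfun a t)"
    unfolding continuous_on_iff using dist_bounded[of _ t] by (metis order_le_less_trans)
qed

section \<open>Counting design points in the cells of a mesh\<close>

text \<open>Half-open cells turn counts into differences of the empirical distribution function. A
  design point at \<open>0\<close> lies in no cell, which is harmless because only lower bounds on
  the counts enter the estimates.\<close>

definition design_cell :: "(nat \<Rightarrow> unit_interval) \<Rightarrow> nat \<Rightarrow> nat \<Rightarrow> nat \<Rightarrow> nat set" where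
  "design_cell x n m j =
    {i \<in> {1..n}. real j / real m < of_unit (x i) \<and> of_unit (x i) \<le> (real j + 1) / real m}"

lemma design_cell_subset: "design_cell x n m j \<subseteq> {1..n}"
  by (auto simp: design_cell_def)

lemma finite_design_cell[simp]: "finite (design_cell x n m j)"
  by (rule finite_subset[OF design_cell_subset]) simp

lemma card_design_cell:
  assumes "m \<ge> 1" "n \<ge> 1"
  shows "real (card (design_cell x n m j)) =
    real n * (empirical_cdf x n ((real j + 1) / real m) - empirical_cdf x n (real j / real m))"
proof -
  let ?F = "\<lambda>t. {i \<in> {1..n}. of_unit (x i) \<le> t}"
  have sub: "?F (real j / real m) \<subseteq> ?F ((real j + 1) / real m)"
    using assms by (auto simp: add_divide_distrib intro: order_trans)
  have "design_cell x n m j = ?F ((real j + 1) / real m) - ?F (real j / real m)"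
    by (auto simp: design_cell_def)
  then have "card (design_cell x n m j) = card (?F ((real j + 1) / real m)) - card (?F (real j / real m))"
    using sub by (simp add: card_Diff_subset)
  moreover have "card (?F (real j / real m)) \<le> card (?F ((real j + 1) / real m))"
    by (rule card_mono[OF _ sub]) simp
  ultimately show ?thesis
    using assms by (simp add: empirical_cdf_def of_nat_diff field_simps)
qed

text \<open>The threshold in \<open>cdf\<close> depends on the interval. A mesh fixed in advance has
  finitely many cells, so they share a common threshold; a mesh refined with \<open>n\<close> is out
  of reach of this argument.\<close>

lemma eventually_card_design_cell_ge:
  assumes cdf: "\<forall>a b. 0 \<le> a \<and> a < b \<and> b \<le> 1 \<longrightarrow>
      (\<exists>N. \<forall>n>N. empirical_cdf x n b - empirical_cdf x n a \<ge> K * (b - a))"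
    and m: "m \<ge> 1"
  shows "\<forall>\<^sub>F n in sequentially. \<forall>j<m. K * real n / real m \<le> real (card (design_cell x n m j))"
proof -
  have "\<forall>\<^sub>F n in sequentially. K * real n / real m \<le> real (card (design_cell x n m j))" if j: "j < m" for j
  proof -
    have "0 \<le> real j / real m \<and> real j / real m < (real j + 1) / real m \<and> (real j + 1) / real m \<le> 1"
      using j m by (auto simp: field_simps)
    then obtain N where N: "\<And>n. n > N \<Longrightarrow>
        K * ((real j + 1) / real m - real j / real m)
          \<le> empirical_cdf x n ((real j + 1) / real m) - empirical_cdf x n (real j / real m)"
      using cdf by blast
    show ?thesis
      using eventually_gt_at_top[of N]
    proof eventually_elim
      case (elim n)
      then have "real n * (K * ((real j + 1) / real m - real j / real m))
          \<le> real (card (design_cell x n m j))"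
        using N[OF elim] m by (subst card_design_cell) (auto intro!: mult_left_mono)
      then show ?case by (simp add: diff_divide_distrib[symmetric] mult_ac)
    qed
  qed
  then have "\<forall>\<^sub>F n in sequentially. \<forall>j\<in>{..<m}. K * real n / real m \<le> real (card (design_cell x n m j))"
    by (intro eventually_ball_finite) auto
  then show ?thesis by (simp add: Ball_def)
qed

text \<open>A cell is cut into \<open>k\<close> subintervals; the design hits the middle half of each, which keeps
  the hit interval away from the end points \<open>0\<close> and \<open>1\<close>.\<close>

lemma card_design_cell_ge_of_dense:
  assumes dense: "\<And>a b. 0 < a \<Longrightarrow> a < b \<Longrightarrow> b < 1 \<Longrightarrow> b - a \<ge> 1 / (K * real n) \<Longrightarrow>
      \<exists>i\<in>{1..n}. a < of_unit (x i) \<and> of_unit (x i) < b"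
    and K: "K > 0" and n: "n \<ge> 1" and j: "j < m" and k: "2 * real m * real k \<le> K * real n"
  shows "k \<le> card (design_cell x n m j)"
proof (cases "k = 0")
  case False
  \<comment> \<open>The width of a subinterval; excluding \<open>k = 0\<close> keeps it from being
    the default value \<open>1 / 0 = 0\<close>.\<close>
  define w where "w = 1 / (real m * real k)"
  define c where "c l = real j / real m + real l * w" for l
  have m: "real m > 0" using j by simp
  have w: "w > 0" using m False by (simp add: w_def)
  have kw: "real k * w = 1 / real m" using False by (simp add: w_def)
  have cell: "c l + w \<le> (real j + 1) / real m" if "l < k" for l
  proof -
    have "(real l + 1) * w \<le> real k * w" using that w by (intro mult_right_mono) auto
    then show ?thesis unfolding c_def kw by (simp add: algebra_simps add_divide_distrib)
  qed
  have "\<exists>i\<in>{1..n}. c l + w / 4 < of_unit (x i) \<and> of_unit (x i) < c l + 3 * w / 4" if l: "l < k" for l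
  proof (rule dense)
    have c0: "c l \<ge> 0" using w by (simp add: c_def)
    then show "0 < c l + w / 4" using w by simp
    show "c l + w / 4 < c l + 3 * w / 4" using w by simp
    have "(real j + 1) / real m \<le> 1" using j by (simp add: field_simps)
    then show "c l + 3 * w / 4 < 1" using cell[OF l] w by simp
    \<comment> \<open>The middle half has length \<open>w / 2 = 1 / (2 * real m * real k)\<close>;
      this is where the factor 2 in the bound on \<open>m\<close> and \<open>k\<close> is
      spent.\<close>
    have "1 / (K * real n) \<le> 1 / (2 * real m * real k)"
      using k m False K n by (intro divide_left_mono mult_pos_pos) auto
    then show "1 / (K * real n) \<le> c l + 3 * w / 4 - (c l + w / 4)"
      by (simp add: w_def mult_ac)
  qed
  then obtain f where f: "\<And>l. l < k \<Longrightarrow> f l \<in> {1..n} \<and> c l + w / 4 < of_unit (x (f l))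
      \<and> of_unit (x (f l)) < c l + 3 * w / 4"
    by metis
  \<comment> \<open>Distinct subintervals have disjoint middle halves, so they are hit by distinct
    indices and \<open>f\<close> injects \<open>k\<close> indices into the cell.\<close>
  have order: "f l \<noteq> f l'" if "l < l'" "l' < k" for l l'
  proof -
    have "(real l + 1) * w \<le> real l' * w" using that w by (intro mult_right_mono) auto
    then have "c l + w \<le> c l'" by (simp add: c_def algebra_simps)
    then show ?thesis using f[of l] f[of l'] that w by auto
  qed
  then have "inj_on f {..<k}"
    by (intro inj_onI) (metis lessThan_iff linorder_neqE_nat)
  moreover have "f ` {..<k} \<subseteq> design_cell x n m j"
  proof
    fix i assume "i \<in> f ` {..<k}"
    then obtain l where l: "l < k" "i = f l" by auto
    have "real j / real m \<le> c l" using w by (simp add: c_def)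
    then show "i \<in> design_cell x n m j"
      using f[OF l(1)] cell[OF l(1)] w l(2) unfolding design_cell_def by auto
  qed
  ultimately show ?thesis
    using card_inj_on_le[of f "{..<k}"] by simp
qed simp

section \<open>Hoelder bounds, mesh width and small balls\<close>

text \<open>The bound on \<open>m\<close> is the second conclusion solved for \<open>m\<close>;
  positivity of its left side excludes \<open>m = 0\<close>.\<close>

lemma holder_mesh:
  fixes \<Lambda> \<beta> \<epsilon> :: real
  assumes "\<Lambda> > 0" "\<beta> > 0" "\<epsilon> > 0" and m: "(2 * \<Lambda> / \<epsilon>) powr (1 / \<beta>) \<le> real m"
  shows "m \<ge> 1" "\<Lambda> * (1 / real m) powr \<beta> \<le> \<epsilon> / 2"
proof -
  have pos: "(2 * \<Lambda> / \<epsilon>) powr (1 / \<beta>) > 0" using assms by simp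
  then show m1: "m \<ge> 1" using m by (cases m) auto
  have "2 * \<Lambda> / \<epsilon> = ((2 * \<Lambda> / \<epsilon>) powr (1 / \<beta>)) powr \<beta>"
    using assms by (simp add: powr_powr)
  also have "\<dots> \<le> real m powr \<beta>" using m assms pos by (intro powr_mono2) auto
  finally have "2 * \<Lambda> / \<epsilon> \<le> real m powr \<beta>" .
  then show "\<Lambda> * (1 / real m) powr \<beta> \<le> \<epsilon> / 2"
    using assms m1 by (simp add: powr_divide field_simps)
qed

lemma holder_seminorm_leD:
  assumes le: "holder_seminorm \<beta> a \<le> ennreal L" and L: "L \<ge> 0"
  shows "\<bar>apply_bcontfun a s - apply_bcontfun a t\<bar> \<le> L * dist s t powr \<beta>"
proof (cases "s = t")
  case False
  have "ennreal (\<bar>apply_bcontfun a s - apply_bcontfun a t\<bar> / dist s t powr \<beta>) \<le> holder_seminorm \<beta> a"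
    unfolding holder_seminorm_def using False by (intro SUP_upper2[of "(s, t)"]) auto
  then have "\<bar>apply_bcontfun a s - apply_bcontfun a t\<bar> / dist s t powr \<beta> \<le> L"
    using le L by (metis ennreal_le_iff order_trans)
  then show ?thesis using False by (simp add: pos_divide_le_eq)
qed simp

text \<open>The Hoelder metric dominates the sup norm, so the sup-norm ball contains the Hoelder
  ball. Monotonicity only asks for the larger of the two sets to be measurable.\<close>

lemma measure_ball_pos_of_holder_support:
  assumes "a \<in> holder_support \<beta> \<mu>" "prob_space \<mu>" "sets \<mu> = sets borel" "\<epsilon> > 0"
  shows "measure \<mu> (ball a \<epsilon>) > 0"
proof -
  interpret prob_space \<mu> by fact
  have "0 < emeasure \<mu> {z \<in> holder_space \<beta>. holder_dist \<beta> a z < \<epsilon>}"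
    using assms by (simp add: holder_support_def metric_support_def)
  also have "\<dots> \<le> emeasure \<mu> (ball a \<epsilon>)"
  proof (rule emeasure_mono)
    have "norm (a - z) \<le> holder_dist \<beta> a z" for z
      by (simp add: holder_dist_def)
    then show "{z \<in> holder_space \<beta>. holder_dist \<beta> a z < \<epsilon>} \<subseteq> ball a \<epsilon>"
      by (auto simp: dist_norm) (meson le_less_trans)
  qed (simp add: assms)
  finally show ?thesis by (simp add: emeasure_eq_measure)
qed

text \<open>Here \<open>\<theta>\<^sub>1\<close> stands for the exponent of the test error and
  \<open>\<theta>\<^sub>0\<close> for that of the inverse evidence. The strict gap makes the decay
  beat both the growth and every polynomial factor.\<close>

lemma exp_power_gap_tendsto_0:
  fixes A C c q \<theta>\<^sub>0 \<theta>\<^sub>1 :: real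
  assumes "A > 0" "C > 0" "c > 0" "q > 0" "0 < \<theta>\<^sub>0" "\<theta>\<^sub>0 < \<theta>\<^sub>1"
  shows "(\<lambda>n. C * real n powr q * exp (- (c * real n powr \<theta>\<^sub>1))
    * (1 + (real n)\<^sup>2 * exp (A * real n powr \<theta>\<^sub>0))) \<longlonglongrightarrow> 0"
  using assms by real_asymp

section \<open>Exponentials of affine functions of the noise\<close>

locale gaussian_regression =
  prior: prob_space \<mu>\<^sub>0 + noise: prob_space P
  for \<mu>\<^sub>0 :: "C01 measure" and P :: "'w measure" +
  fixes x :: "nat \<Rightarrow> unit_interval" and \<sigma> :: real and \<xi> :: "nat \<Rightarrow> 'w \<Rightarrow> real" and a\<^sub>0 :: C01
  assumes sets_prior[measurable_cong]: "sets \<mu>\<^sub>0 = sets borel"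
    and sigma_pos: "\<sigma> > 0"
    and indep: "noise.indep_vars (\<lambda>_. borel) \<xi> {1..}"
    and distr: "\<And>i. i \<ge> 1 \<Longrightarrow> distributed P lborel (\<xi> i) (normal_density 0 \<sigma>)"
begin

sublocale pair_sigma_finite \<mu>\<^sub>0 P ..

lemma noise_measurable: "i \<ge> 1 \<Longrightarrow> \<xi> i \<in> borel_measurable P"
  using indep unfolding noise.indep_vars_def by auto

text \<open>Independence factors the expectation into Gaussian moment generating functions. Tests,
  likelihood ratios, their inverses and their tilts all have this shape for suitable
  \<open>c\<close> and \<open>d\<close>.\<close>

lemma nn_integral_exp_noise:
  assumes "finite I" "I \<subseteq> {1..}"
  shows "(\<integral>\<^sup>+\<omega>. ennreal (exp (\<Sum>i\<in>I. c i * \<xi> i \<omega> + d i)) \<partial>P)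
    = ennreal (exp (\<Sum>i\<in>I. \<sigma>\<^sup>2 * (c i)\<^sup>2 / 2 + d i))"
proof -
  have ind: "noise.indep_vars (\<lambda>_. borel) (\<lambda>i \<omega>. ennreal (exp (c i * \<xi> i \<omega> + d i))) I"
    by (rule noise.indep_vars_compose2[OF noise.indep_vars_subset[OF indep assms(2)]]) measurable
  have single: "(\<integral>\<^sup>+\<omega>. ennreal (exp (c i * \<xi> i \<omega> + d i)) \<partial>P)
      = ennreal (exp (\<sigma>\<^sup>2 * (c i)\<^sup>2 / 2 + d i))" if "i \<in> I" for i
  proof -
    have i: "i \<ge> 1" using that assms by auto
    have "(\<integral>\<^sup>+\<omega>. ennreal (exp (c i * \<xi> i \<omega> + d i)) \<partial>P)
        = (\<integral>\<^sup>+\<omega>. ennreal (exp (d i)) * ennreal (exp (c i * \<xi> i \<omega>)) \<partial>P)"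
      by (simp add: ennreal_mult[symmetric] exp_add mult.commute)
    also have "\<dots> = ennreal (exp (d i)) * (\<integral>\<^sup>+\<omega>. ennreal (exp (c i * \<xi> i \<omega>)) \<partial>P)"
      using noise_measurable[OF i] by (intro nn_integral_cmult) measurable
    also have "(\<integral>\<^sup>+\<omega>. ennreal (exp (c i * \<xi> i \<omega>)) \<partial>P) = ennreal (exp (\<sigma>\<^sup>2 * (c i)\<^sup>2 / 2))"
      unfolding nn_integral_exp_normal_density[OF sigma_pos, symmetric]
      using distributed_nn_integral[OF distr[OF i], of "\<lambda>y. ennreal (exp (c i * y))"] by simp
    finally show ?thesis by (simp add: ennreal_mult[symmetric] exp_add mult.commute)
  qed
  have "(\<integral>\<^sup>+\<omega>. ennreal (exp (\<Sum>i\<in>I. c i * \<xi> i \<omega> + d i)) \<partial>P)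
      = (\<integral>\<^sup>+\<omega>. (\<Prod>i\<in>I. ennreal (exp (c i * \<xi> i \<omega> + d i))) \<partial>P)"
    using assms by (simp add: exp_sum prod_ennreal)
  also have "\<dots> = (\<Prod>i\<in>I. \<integral>\<^sup>+\<omega>. ennreal (exp (c i * \<xi> i \<omega> + d i)) \<partial>P)"
    by (rule noise.indep_vars_nn_integral[OF assms(1) ind]) simp
  also have "\<dots> = (\<Prod>i\<in>I. ennreal (exp (\<sigma>\<^sup>2 * (c i)\<^sup>2 / 2 + d i)))"
    by (rule prod.cong[OF refl single])
  also have "\<dots> = ennreal (exp (\<Sum>i\<in>I. \<sigma>\<^sup>2 * (c i)\<^sup>2 / 2 + d i))"
    using assms by (simp add: exp_sum prod_ennreal)
  finally show ?thesis .
qed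

text \<open>Joint measurability in the function and the noise is what Tonelli asks for.\<close>

lemma measurable_exp_noise:
  fixes c d :: "C01 \<Rightarrow> nat \<Rightarrow> real"
  assumes I: "I \<subseteq> {1..}"
    and [measurable]: "\<And>i. (\<lambda>a. c a i) \<in> borel_measurable borel" "\<And>i. (\<lambda>a. d a i) \<in> borel_measurable borel"
  shows "(\<lambda>(a, \<omega>). exp (\<Sum>i\<in>I. c a i * \<xi> i \<omega> + d a i)) \<in> borel_measurable (\<mu>\<^sub>0 \<Otimes>\<^sub>M P)"
proof -
  have "(\<lambda>z. \<Sum>i\<in>I. c (fst z) i * \<xi> i (snd z) + d (fst z) i) \<in> borel_measurable (\<mu>\<^sub>0 \<Otimes>\<^sub>M P)"
  proof (rule borel_measurable_sum)
    fix i assume "i \<in> I"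
    then have [measurable]: "\<xi> i \<in> borel_measurable P" using I by (intro noise_measurable) auto
    show "(\<lambda>z. c (fst z) i * \<xi> i (snd z) + d (fst z) i) \<in> borel_measurable (\<mu>\<^sub>0 \<Otimes>\<^sub>M P)"
      by measurable
  qed
  then show ?thesis by (simp add: case_prod_beta')
qed

text \<open>Tonelli moves the noise integral inside, where for fixed \<open>a\<close> it is the
  moment generating function just computed, at most \<open>exp v\<close> on
  \<open>A\<close>.\<close>

lemma nn_integral_prior_exp_noise_le:
  fixes c d :: "C01 \<Rightarrow> nat \<Rightarrow> real"
  assumes I: "finite I" "I \<subseteq> {1..}"
    and A[measurable]: "A \<in> sets borel"
    and meas: "\<And>i. (\<lambda>a. c a i) \<in> borel_measurable borel" "\<And>i. (\<lambda>a. d a i) \<in> borel_measurable borel"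
    and le: "\<And>a. a \<in> A \<Longrightarrow> (\<Sum>i\<in>I. \<sigma>\<^sup>2 * (c a i)\<^sup>2 / 2 + d a i) \<le> v"
  shows "(\<integral>\<^sup>+\<omega>. \<integral>\<^sup>+a. indicator A a * ennreal (exp (\<Sum>i\<in>I. c a i * \<xi> i \<omega> + d a i)) \<partial>\<mu>\<^sub>0 \<partial>P)
    \<le> ennreal (exp v) * emeasure \<mu>\<^sub>0 A"
    and "(\<lambda>\<omega>. \<integral>\<^sup>+a. indicator A a * ennreal (exp (\<Sum>i\<in>I. c a i * \<xi> i \<omega> + d a i)) \<partial>\<mu>\<^sub>0)
      \<in> borel_measurable P"
proof -
  note m = measurable_exp_noise[OF I(2) meas]
  have m': "(\<lambda>(a, \<omega>). indicator A a * ennreal (exp (\<Sum>i\<in>I. c a i * \<xi> i \<omega> + d a i)))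
      \<in> borel_measurable (\<mu>\<^sub>0 \<Otimes>\<^sub>M P)"
    using m by (simp add: case_prod_beta') measurable
  have m'': "(\<lambda>(\<omega>, a). indicator A a * ennreal (exp (\<Sum>i\<in>I. c a i * \<xi> i \<omega> + d a i)))
      \<in> borel_measurable (P \<Otimes>\<^sub>M \<mu>\<^sub>0)"
    using measurable_pair_swap[OF m'] by (simp add: case_prod_beta')
  show "(\<lambda>\<omega>. \<integral>\<^sup>+a. indicator A a * ennreal (exp (\<Sum>i\<in>I. c a i * \<xi> i \<omega> + d a i)) \<partial>\<mu>\<^sub>0)
      \<in> borel_measurable P"
    by (rule prior.borel_measurable_nn_integral[OF m''])
  have mw: "(\<lambda>\<omega>. ennreal (exp (\<Sum>i\<in>I. c a i * \<xi> i \<omega> + d a i))) \<in> borel_measurable P" for a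
    using I noise_measurable by (intro measurable_compose[OF _ measurable_ennreal]
      measurable_compose[OF _ borel_measurable_exp] borel_measurable_sum borel_measurable_add
      borel_measurable_times) auto
  have "(\<integral>\<^sup>+\<omega>. \<integral>\<^sup>+a. indicator A a * ennreal (exp (\<Sum>i\<in>I. c a i * \<xi> i \<omega> + d a i)) \<partial>\<mu>\<^sub>0 \<partial>P)
     = (\<integral>\<^sup>+a. \<integral>\<^sup>+\<omega>. indicator A a * ennreal (exp (\<Sum>i\<in>I. c a i * \<xi> i \<omega> + d a i)) \<partial>P \<partial>\<mu>\<^sub>0)"
    by (rule Fubini'[OF m'])
  also have "\<dots> \<le> (\<integral>\<^sup>+a. ennreal (exp v) * indicator A a \<partial>\<mu>\<^sub>0)"
  proof (rule nn_integral_mono)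
    fix a
    have "(\<integral>\<^sup>+\<omega>. indicator A a * ennreal (exp (\<Sum>i\<in>I. c a i * \<xi> i \<omega> + d a i)) \<partial>P)
        = indicator A a * (\<integral>\<^sup>+\<omega>. ennreal (exp (\<Sum>i\<in>I. c a i * \<xi> i \<omega> + d a i)) \<partial>P)"
      by (rule nn_integral_cmult[OF mw])
    also have "\<dots> \<le> ennreal (exp v) * indicator A a"
      unfolding nn_integral_exp_noise[OF I] using le[of a] by (auto simp: indicator_def intro!: ennreal_leI)
    finally show "(\<integral>\<^sup>+\<omega>. indicator A a * ennreal (exp (\<Sum>i\<in>I. c a i * \<xi> i \<omega> + d a i)) \<partial>P)
       \<le> ennreal (exp v) * indicator A a" .
  qed
  also have "\<dots> = ennreal (exp v) * emeasure \<mu>\<^sub>0 A"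
    by (simp add: nn_integral_cmult sets_prior)
  finally show "(\<integral>\<^sup>+\<omega>. \<integral>\<^sup>+a. indicator A a * ennreal (exp (\<Sum>i\<in>I. c a i * \<xi> i \<omega> + d a i)) \<partial>\<mu>\<^sub>0 \<partial>P)
    \<le> ennreal (exp v) * emeasure \<mu>\<^sub>0 A" .
qed

section \<open>Likelihood ratio and posterior\<close>

definition dev :: "C01 \<Rightarrow> nat \<Rightarrow> real" where
  "dev a i = apply_bcontfun a (x i) - apply_bcontfun a\<^sub>0 (x i)"

text \<open>The likelihood of \<open>a\<close> divided by that of \<open>a\<^sub>0\<close>. The
  squares of the noise cancel, which leaves an exponent affine in the noise.\<close>

definition lik_ratio :: "nat \<Rightarrow> 'w \<Rightarrow> C01 \<Rightarrow> real" where
  "lik_ratio n \<omega> a = exp (\<Sum>i=1..n. dev a i / \<sigma>\<^sup>2 * \<xi> i \<omega> + - (dev a i)\<^sup>2 / (2 * \<sigma>\<^sup>2))"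

abbreviation post :: "nat \<Rightarrow> 'w \<Rightarrow> C01 measure" where
  "post n \<omega> \<equiv> posterior \<mu>\<^sub>0 x \<sigma> n (\<lambda>i. apply_bcontfun a\<^sub>0 (x i) + \<xi> i \<omega>)"

lemma dev_measurable[measurable]: "(\<lambda>a. dev a i) \<in> borel_measurable borel"
  unfolding dev_def by measurable

lemma lik_ratio_measurable_pair:
  "(\<lambda>(a, \<omega>). lik_ratio n \<omega> a) \<in> borel_measurable (\<mu>\<^sub>0 \<Otimes>\<^sub>M P)"
  unfolding lik_ratio_def by (rule measurable_exp_noise) auto

lemma lik_ratio_measurable[measurable]: "lik_ratio n \<omega> \<in> borel_measurable borel"
  unfolding lik_ratio_def[abs_def] by measurable

lemma lik_ratio_pos: "lik_ratio n \<omega> a > 0"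
  by (simp add: lik_ratio_def)

text \<open>The first factor is the likelihood of \<open>a\<^sub>0\<close>. It is the same for every
  \<open>a\<close> and therefore cancels in the posterior.\<close>

lemma likelihood_eq:
  "likelihood x \<sigma> n (\<lambda>i. apply_bcontfun a\<^sub>0 (x i) + \<xi> i \<omega>) a
    = exp (- (\<Sum>i=1..n. (\<xi> i \<omega>)\<^sup>2 / (2 * \<sigma>\<^sup>2))) * lik_ratio n \<omega> a"
  unfolding likelihood_def lik_ratio_def mult_exp_exp dev_def sum_negf[symmetric]
    sum.distrib[symmetric]
  using sigma_pos by (intro arg_cong[where f=exp] sum.cong) (auto simp: field_simps power2_eq_square)

text \<open>The likelihood never exceeds 1, so for fixed \<open>\<omega>\<close> the ratio is
  bounded by the inverse of the first factor in \<open>likelihood_eq\<close>.\<close>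

lemma integrable_lik_ratio: "integrable \<mu>\<^sub>0 (lik_ratio n \<omega>)"
proof (rule prior.integrable_const_bound)
  let ?C = "exp (\<Sum>i=1..n. (\<xi> i \<omega>)\<^sup>2 / (2 * \<sigma>\<^sup>2))"
  show "AE a in \<mu>\<^sub>0. norm (lik_ratio n \<omega> a) \<le> ?C"
  proof (rule AE_I2)
    fix a
    have "likelihood x \<sigma> n (\<lambda>i. apply_bcontfun a\<^sub>0 (x i) + \<xi> i \<omega>) a \<le> 1"
      unfolding likelihood_def by (auto intro!: sum_nonneg)
    then show "norm (lik_ratio n \<omega> a) \<le> ?C"
      unfolding likelihood_eq using lik_ratio_pos[of n \<omega> a] by (simp add: exp_minus field_simps)
  qed
qed measurable

text \<open>Makes the normalisation genuine: division by a zero integral would yield the default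
  value 0 and the posterior would be the null measure.\<close>

lemma integral_lik_ratio_pos: "(\<integral>a. lik_ratio n \<omega> a \<partial>\<mu>\<^sub>0) > 0"
proof -
  have nonneg: "AE a in \<mu>\<^sub>0. 0 \<le> lik_ratio n \<omega> a"
    by (rule AE_I2) (rule less_imp_le[OF lik_ratio_pos])
  have "(\<integral>a. lik_ratio n \<omega> a \<partial>\<mu>\<^sub>0) \<noteq> 0"
  proof
    assume "(\<integral>a. lik_ratio n \<omega> a \<partial>\<mu>\<^sub>0) = 0"
    then have "AE a in \<mu>\<^sub>0. lik_ratio n \<omega> a = 0"
      using integral_nonneg_eq_0_iff_AE[OF integrable_lik_ratio nonneg] by simp
    then have "AE a in \<mu>\<^sub>0. False"
      by eventually_elim (use lik_ratio_pos in \<open>metis less_irrefl\<close>)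
    then show False by simp
  qed
  moreover have "(\<integral>a. lik_ratio n \<omega> a \<partial>\<mu>\<^sub>0) \<ge> 0"
    by (rule integral_nonneg_AE[OF nonneg])
  ultimately show ?thesis by simp
qed

lemma posterior_eq:
  "post n \<omega> = density \<mu>\<^sub>0 (\<lambda>a. ennreal (lik_ratio n \<omega> a / (\<integral>b. lik_ratio n \<omega> b \<partial>\<mu>\<^sub>0)))"
  unfolding posterior_def likelihood_eq by simp

lemma emeasure_posterior:
  assumes [measurable]: "A \<in> sets borel"
  shows "emeasure (post n \<omega>) A = (\<integral>\<^sup>+a. indicator A a * ennreal (lik_ratio n \<omega> a) \<partial>\<mu>\<^sub>0)
      / ennreal (\<integral>b. lik_ratio n \<omega> b \<partial>\<mu>\<^sub>0)"
proof -
  let ?D = "\<integral>b. lik_ratio n \<omega> b \<partial>\<mu>\<^sub>0"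
  have "emeasure (post n \<omega>) A = (\<integral>\<^sup>+a. ennreal (lik_ratio n \<omega> a / ?D) * indicator A a \<partial>\<mu>\<^sub>0)"
    unfolding posterior_eq by (rule emeasure_density) (auto simp: sets_prior)
  also have "\<dots> = (\<integral>\<^sup>+a. (indicator A a * ennreal (lik_ratio n \<omega> a)) / ennreal ?D \<partial>\<mu>\<^sub>0)"
    using lik_ratio_pos[of n \<omega>] integral_lik_ratio_pos[of n \<omega>]
    by (intro nn_integral_cong) (auto simp: divide_ennreal less_imp_le indicator_def)
  also have "\<dots> = (\<integral>\<^sup>+a. indicator A a * ennreal (lik_ratio n \<omega> a) \<partial>\<mu>\<^sub>0) / ennreal ?D"
    by (rule nn_integral_divide) measurable
  finally show ?thesis .
qed

lemma nn_integral_lik_ratio: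
  "(\<integral>\<^sup>+a. ennreal (lik_ratio n \<omega> a) \<partial>\<mu>\<^sub>0) = ennreal (\<integral>a. lik_ratio n \<omega> a \<partial>\<mu>\<^sub>0)"
  by (rule nn_integral_eq_integral[OF integrable_lik_ratio]) (simp add: lik_ratio_pos less_imp_le)

lemma sets_posterior: "sets (post n \<omega>) = sets borel"
  by (simp add: posterior_def sets_prior)

lemma prob_space_posterior: "prob_space (post n \<omega>)"
proof (rule prob_spaceI)
  have "space (post n \<omega>) = UNIV" using sets_eq_imp_space_eq[OF sets_posterior] by simp
  then show "emeasure (post n \<omega>) (space (post n \<omega>)) = 1"
    using integral_lik_ratio_pos[of n \<omega>]
    by (simp add: emeasure_posterior nn_integral_lik_ratio divide_ennreal less_imp_le)
qed

lemma posterior_ge: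
  assumes A[measurable]: "A \<in> sets borel" and q: "q \<ge> 0"
    and le: "(\<integral>\<^sup>+a. indicator (- A) a * ennreal (lik_ratio n \<omega> a) \<partial>\<mu>\<^sub>0)
      \<le> ennreal q * (\<integral>\<^sup>+a. ennreal (lik_ratio n \<omega> a) \<partial>\<mu>\<^sub>0)"
  shows "measure (post n \<omega>) A \<ge> 1 - q"
proof -
  interpret post: prob_space "post n \<omega>" by (rule prob_space_posterior)
  let ?D = "\<integral>b. lik_ratio n \<omega> b \<partial>\<mu>\<^sub>0"
  have "emeasure (post n \<omega>) (- A) \<le> (ennreal q * ennreal ?D) / ennreal ?D"
    using le by (subst emeasure_posterior) (auto simp: nn_integral_lik_ratio intro!: divide_right_mono_ennreal)
  also have "\<dots> = ennreal q"
    using integral_lik_ratio_pos[of n \<omega>] q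
    by (simp add: ennreal_mult[symmetric] divide_ennreal less_imp_le)
  finally have "measure (post n \<omega>) (- A) \<le> q"
    using q by (simp add: post.emeasure_eq_measure)
  moreover have "measure (post n \<omega>) (- A) = 1 - measure (post n \<omega>) A"
    using post.prob_compl[of A] sets_eq_imp_space_eq[OF sets_posterior[of n \<omega>]] A
    by (simp add: sets_posterior Compl_eq_Diff_UNIV)
  ultimately show ?thesis by simp
qed

text \<open>Needed for the final event to be measurable, so that its probability can be read off
  from its complement.\<close>

lemma measure_posterior_measurable:
  assumes A[measurable]: "A \<in> sets borel"
  shows "(\<lambda>\<omega>. measure (post n \<omega>) A) \<in> borel_measurable P"
proof -
  have m: "(\<lambda>(\<omega>, a). lik_ratio n \<omega> a) \<in> borel_measurable (P \<Otimes>\<^sub>M \<mu>\<^sub>0)"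
    using measurable_pair_swap[OF lik_ratio_measurable_pair] by (simp add: case_prod_beta')
  have [measurable]: "(\<lambda>\<omega>. \<integral>b. lik_ratio n \<omega> b \<partial>\<mu>\<^sub>0) \<in> borel_measurable P"
    by (rule prior.borel_measurable_lebesgue_integral[OF m])
  have m2: "(\<lambda>(\<omega>, a). indicator A a * ennreal (lik_ratio n \<omega> a)) \<in> borel_measurable (P \<Otimes>\<^sub>M \<mu>\<^sub>0)"
    using m by (simp add: case_prod_beta') measurable
  have [measurable]: "(\<lambda>\<omega>. \<integral>\<^sup>+a. indicator A a * ennreal (lik_ratio n \<omega> a) \<partial>\<mu>\<^sub>0) \<in> borel_measurable P"
    by (rule prior.borel_measurable_nn_integral[OF m2])
  show ?thesis
    unfolding measure_def emeasure_posterior[OF A] by measurable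
qed

section \<open>Detecting a deviation on a cell\<close>

abbreviation cell :: "nat \<Rightarrow> nat \<Rightarrow> nat \<Rightarrow> nat set" where
  "cell \<equiv> design_cell x"

text \<open>Constraining only the values at design points makes this a finite intersection of closed
  half-spaces, hence Borel; \<open>s\<close> is the sign of the deviation.\<close>

definition sign_region :: "nat \<Rightarrow> nat \<Rightarrow> real \<Rightarrow> nat \<Rightarrow> real \<Rightarrow> C01 set" where
  "sign_region n m \<epsilon> j s = {a. \<forall>i\<in>cell n m j. \<epsilon> / 2 \<le> s * dev a i}"

lemma sign_region_measurable[measurable]: "sign_region n m \<epsilon> j s \<in> sets borel"
proof -
  have "sign_region n m \<epsilon> j s = {a \<in> space borel. \<forall>i\<in>cell n m j. \<epsilon> / 2 \<le> s * dev a i}"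
    by (simp add: sign_region_def)
  also have "\<dots> \<in> sets borel"
    by (rule sets.sets_Collect_finite_All[OF _ finite_design_cell]) measurable
  finally show ?thesis .
qed

text \<open>Take \<open>t\<close> where the deviation exceeds \<open>\<epsilon>\<close> in absolute
  value and let \<open>s\<close> be its sign there. Within the cell containing \<open>t\<close> the
  deviation changes by at most \<open>\<epsilon> / 2\<close>, so at least
  \<open>\<epsilon> / 2\<close> of it survives at every design point of the cell.\<close>

lemma ex_sign_region:
  assumes holder: "\<And>s t. \<bar>(apply_bcontfun a s - apply_bcontfun a\<^sub>0 s)
        - (apply_bcontfun a t - apply_bcontfun a\<^sub>0 t)\<bar> \<le> \<Lambda> * dist s t powr \<beta>"
    and \<Lambda>: "\<Lambda> \<ge> 0" and \<beta>: "\<beta> > 0" and m: "m \<ge> 1"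
    and mesh: "\<Lambda> * (1 / real m) powr \<beta> \<le> \<epsilon> / 2"
    and far: "norm (a - a\<^sub>0) > \<epsilon>"
  shows "\<exists>j<m. \<exists>s\<in>{-1, 1}. a \<in> sign_region n m \<epsilon> j s"
proof -
  let ?h = "\<lambda>t. apply_bcontfun a t - apply_bcontfun a\<^sub>0 t"
  obtain t where t: "\<bar>?h t\<bar> > \<epsilon>"
    using norm_bound[of "a - a\<^sub>0" \<epsilon>] far by (auto simp: minus_bcontfun.rep_eq not_le[symmetric])
  have t01: "0 \<le> of_unit t" "of_unit t \<le> 1" using of_unit[of t] by auto
  \<comment> \<open>For \<open>t\<close> the cells are closed on both sides, which covers
    \<open>t = 0\<close>. At \<open>t = 1\<close> rounding down would give the index
    \<open>m\<close>, so the last cell is named explicitly.\<close>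
  obtain j where j: "j < m" "real j / real m \<le> of_unit t" "of_unit t \<le> (real j + 1) / real m"
  proof (cases "of_unit t = 1")
    case True
    show ?thesis by (rule that[of "m - 1"]) (use m True in \<open>auto simp: of_nat_diff field_simps\<close>)
  next
    case False
    define k where "k = nat \<lfloor>real m * of_unit t\<rfloor>"
    have "real k = of_int \<lfloor>real m * of_unit t\<rfloor>"
      unfolding k_def using t01 by (simp add: of_nat_nat)
    then have k: "real k \<le> real m * of_unit t" "real m * of_unit t \<le> real k + 1"
      by linarith+
    have "real m * of_unit t < real m" using False t01 m by simp
    with k have "k < m" by linarith
    with k show ?thesis using m by (intro that[of k]) (auto simp: field_simps)
  qed
  define s where "s = (if ?h t > 0 then 1 else - 1 :: real)"
  have st: "s * ?h t > \<epsilon>" using t by (auto simp: s_def)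
  have "\<epsilon> / 2 \<le> s * dev a i" if i: "i \<in> cell n m j" for i
  proof -
    have "dist (x i) t \<le> 1 / real m"
      using i j m unfolding design_cell_def dist_unit_interval_def by (auto simp: add_divide_distrib)
    then have "dist (x i) t powr \<beta> \<le> (1 / real m) powr \<beta>"
      using \<beta> by (intro powr_mono2) auto
    then have "\<bar>?h (x i) - ?h t\<bar> \<le> \<epsilon> / 2"
      using holder[of "x i" t] mesh mult_left_mono[OF _ \<Lambda>] by (meson order_trans)
    then have "?h t - \<epsilon> / 2 \<le> ?h (x i)" "?h (x i) \<le> ?h t + \<epsilon> / 2" by linarith+
    then show ?thesis using st unfolding dev_def s_def by (cases "?h t > 0") simp_all
  qed
  then have "a \<in> sign_region n m \<epsilon> j s" by (simp add: sign_region_def)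
  moreover have "s \<in> {-1, 1}" by (simp add: s_def)
  ultimately show ?thesis using j(1) by blast
qed

section \<open>The finite-sample bound\<close>

text \<open>All ways to fail are collected in one nonnegative variable \<open>Z\<close>, weighted so
  that \<open>Z \<omega> < 1\<close> forces the posterior bound. Markov's inequality at level 1 then
  bounds the failure probability by the expectation of \<open>Z\<close>, which is the subtracted
  expression.\<close>

lemma posterior_ball_finite_sample:
  assumes holder: "AE a in \<mu>\<^sub>0. \<forall>s t. \<bar>(apply_bcontfun a s - apply_bcontfun a\<^sub>0 s)
        - (apply_bcontfun a t - apply_bcontfun a\<^sub>0 t)\<bar> \<le> \<Lambda> * dist s t powr \<beta>"
    and \<Lambda>: "\<Lambda> \<ge> 0" and \<beta>: "\<beta> > 0" and m: "m \<ge> 1" and n: "n \<ge> 1"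
    and \<epsilon>: "0 < \<epsilon>" "\<epsilon> < r" and \<delta>: "\<delta> > 0"
    and p_def: "p = measure \<mu>\<^sub>0 (ball a\<^sub>0 \<delta>)" and p: "p > 0"
    and mesh: "\<Lambda> * (1 / real m) powr \<beta> \<le> \<epsilon> / 2"
    and N: "\<And>j. j < m \<Longrightarrow> N \<le> real (card (cell n m j))"
  shows "1 - (1 / real n + 2 * real m * exp (- (N * \<epsilon>\<^sup>2 / (32 * \<sigma>\<^sup>2)))
        * (1 + (real n)\<^sup>2 * exp (real n * \<delta>\<^sup>2 / \<sigma>\<^sup>2) / p))
    \<le> measure P {\<omega> \<in> space P. measure (post n \<omega>) (ball a\<^sub>0 r) \<ge> 1 - 1 / real n}"
proof -
  \<comment> \<open>This value minimises \<open>\<sigma>\<^sup>2 * \<tau>\<^sup>2 / 2 - \<tau> *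
    \<epsilon> / 4\<close>, the exponent per design point, with minimum
    \<open>- \<epsilon>\<^sup>2 / (32 * \<sigma>\<^sup>2)\<close>. Since
    \<open>\<epsilon> / 4\<close> is halfway between 0 and \<open>\<epsilon> / 2\<close>, the same
    exponent serves both kinds of error.\<close>
  define \<tau> where "\<tau> = \<epsilon> / (4 * \<sigma>\<^sup>2)"
  \<comment> \<open>Bounds the expected inverse likelihood ratio of every function in the ball of
    radius \<open>\<delta>\<close>.\<close>
  define V where "V = exp (real n * \<delta>\<^sup>2 / \<sigma>\<^sup>2)"
  define E where "E = exp (- (N * \<epsilon>\<^sup>2 / (32 * \<sigma>\<^sup>2)))"
  \<comment> \<open>The inverse of \<open>1 / n\<close> times \<open>p / (n * V)\<close>: the
    posterior mass allowed outside the ball times the lower bound for the evidence.\<close>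
  define g where "g = (real n)\<^sup>2 * V / p"
  let ?A = "sign_region n m \<epsilon>"
  let ?B = "ball a\<^sub>0 \<delta>"
  let ?S = "{-1, 1 :: real}"
  \<comment> \<open>\<open>T j s \<omega> < 1\<close> says that the test on cell \<open>j\<close>
    with sign \<open>s\<close> does not raise an alarm: \<open>s\<close> times the sum of the noise
    over the cell is below \<open>\<epsilon> / 4\<close> per design point.\<close>
  define T where "T j s \<omega> = ennreal (exp (\<Sum>i\<in>cell n m j. \<tau> * s * \<xi> i \<omega> + - (\<tau> * \<epsilon> / 4)))" for j s \<omega>
  \<comment> \<open>\<open>cQ\<close> and \<open>dQ\<close> are the coefficients of the likelihood
    ratio divided by \<open>T j s\<close>. When \<open>T j s \<omega> < 1\<close> this division only
    enlarges the ratio, yet on the sign region its expectation is exponentially small.\<close>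
  define cQ where "cQ j s a i = dev a i / \<sigma>\<^sup>2 + (if i \<in> cell n m j then - (\<tau> * s) else 0)" for j s a i
  define dQ where "dQ j s a i = - (dev a i)\<^sup>2 / (2 * \<sigma>\<^sup>2) + (if i \<in> cell n m j then \<tau> * \<epsilon> / 4 else 0)"
    for j and s :: real and a i
  define Q where "Q j s \<omega> = (\<integral>\<^sup>+a. indicator (?A j s) a *
      ennreal (exp (\<Sum>i=1..n. cQ j s a i * \<xi> i \<omega> + dQ j s a i)) \<partial>\<mu>\<^sub>0)" for j s \<omega>
  \<comment> \<open>The inverse likelihood ratio integrated over the small ball; if it is small, the
    evidence is large.\<close>
  define Y where "Y \<omega> = (\<integral>\<^sup>+a. indicator ?B a *
      ennreal (exp (\<Sum>i=1..n. - dev a i / \<sigma>\<^sup>2 * \<xi> i \<omega> + (dev a i)\<^sup>2 / (2 * \<sigma>\<^sup>2))) \<partial>\<mu>\<^sub>0)" for \<omega>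
  \<comment> \<open>The expectation of \<open>Y\<close> is at most \<open>V * p\<close>, so its
    weight leaves \<open>1 / n\<close>. Each of the \<open>2 * m\<close> pairs \<open>(j, s)\<close>
    contributes at most \<open>E * (1 + g)\<close>.\<close>
  define Z where "Z \<omega> = (\<Sum>j<m. \<Sum>s\<in>?S. T j s \<omega> + ennreal g * Q j s \<omega>)
      + ennreal (1 / (real n * p * V)) * Y \<omega>" for \<omega>
  have V_pos: "V > 0" and E_pos: "E > 0" by (auto simp: V_def E_def)
  have g_pos: "g > 0" using n p V_pos by (simp add: g_def)
  have B[measurable]: "?B \<in> sets borel" by simp
  have card_le: "exp (- (real (card (cell n m j)) * \<epsilon>\<^sup>2 / (32 * \<sigma>\<^sup>2))) \<le> E" if "j < m" for j
    unfolding E_def using N[OF that] sigma_pos by (auto intro!: divide_right_mono mult_right_mono)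
  have sum_cell: "(\<Sum>i=1..n. if i \<in> cell n m j then f i else 0) = (\<Sum>i\<in>cell n m j. f i)"
    for j and f :: "nat \<Rightarrow> real"
    using design_cell_subset[of x n m j] by (simp add: sum.inter_restrict[symmetric] Int_absorb1)

  have T_meas[measurable]: "T j s \<in> borel_measurable P" for j s
    unfolding T_def[abs_def] using design_cell_subset[of x n m j] noise_measurable
    by (intro measurable_compose[OF _ measurable_ennreal] measurable_compose[OF _ borel_measurable_exp]
        borel_measurable_sum borel_measurable_add borel_measurable_times) auto
  have T_le: "(\<integral>\<^sup>+\<omega>. T j s \<omega> \<partial>P) \<le> ennreal E" if j: "j < m" and s: "s \<in> ?S" for j s
  proof -
    have s2: "s\<^sup>2 = 1" using s by auto
    have "(\<Sum>i\<in>cell n m j. \<sigma>\<^sup>2 * (\<tau> * s)\<^sup>2 / 2 + - (\<tau> * \<epsilon> / 4))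
        = - (real (card (cell n m j)) * \<epsilon>\<^sup>2 / (32 * \<sigma>\<^sup>2))"
      using sigma_pos by (simp add: power_mult_distrib s2) (simp add: \<tau>_def field_simps power2_eq_square)
    then show ?thesis
      unfolding T_def using card_le[OF j] design_cell_subset[of x n m j]
      by (subst nn_integral_exp_noise) (auto intro!: ennreal_leI)
  qed
  have Q: "(\<integral>\<^sup>+\<omega>. Q j s \<omega> \<partial>P) \<le> ennreal E" "Q j s \<in> borel_measurable P"
    if j: "j < m" and s: "s \<in> ?S" for j s
  proof -
    have s2: "s * s = 1" using s by auto
    have meas: "(\<lambda>a. cQ j s a i) \<in> borel_measurable borel" "(\<lambda>a. dQ j s a i) \<in> borel_measurable borel" for i
      unfolding cQ_def dQ_def by measurable
    have le: "(\<Sum>i=1..n. \<sigma>\<^sup>2 * (cQ j s a i)\<^sup>2 / 2 + dQ j s a i)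
        \<le> - (real (card (cell n m j)) * \<epsilon>\<^sup>2 / (32 * \<sigma>\<^sup>2))" if a: "a \<in> ?A j s" for a
    proof -
      \<comment> \<open>Outside the cell the summands vanish, because an untilted likelihood ratio
        has expectation one; inside it only the effect of the tilt remains.\<close>
      have "(\<Sum>i=1..n. \<sigma>\<^sup>2 * (cQ j s a i)\<^sup>2 / 2 + dQ j s a i)
          = (\<Sum>i=1..n. if i \<in> cell n m j
              then - (\<tau> * (s * dev a i)) + \<sigma>\<^sup>2 * \<tau>\<^sup>2 / 2 + \<tau> * \<epsilon> / 4 else 0)"
      proof (rule sum.cong[OF refl])
        fix i
        have "\<sigma>\<^sup>2 * (dev a i / \<sigma>\<^sup>2 + - (\<tau> * s))\<^sup>2 / 2 + - (dev a i)\<^sup>2 / (2 * \<sigma>\<^sup>2)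
            = - (\<tau> * (s * dev a i)) + \<sigma>\<^sup>2 * \<tau>\<^sup>2 * (s * s) / 2"
          using sigma_pos by (simp add: field_simps power2_eq_square)
        moreover have "\<sigma>\<^sup>2 * (dev a i / \<sigma>\<^sup>2)\<^sup>2 / 2 + - (dev a i)\<^sup>2 / (2 * \<sigma>\<^sup>2) = 0"
          using sigma_pos by (simp add: field_simps power2_eq_square)
        ultimately show "\<sigma>\<^sup>2 * (cQ j s a i)\<^sup>2 / 2 + dQ j s a i
          = (if i \<in> cell n m j then - (\<tau> * (s * dev a i)) + \<sigma>\<^sup>2 * \<tau>\<^sup>2 / 2 + \<tau> * \<epsilon> / 4 else 0)"
          unfolding cQ_def dQ_def s2 by (simp split: if_splits)
      qed
      also have "\<dots> = (\<Sum>i\<in>cell n m j. - (\<tau> * (s * dev a i)) + \<sigma>\<^sup>2 * \<tau>\<^sup>2 / 2 + \<tau> * \<epsilon> / 4)"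
        by (rule sum_cell)
      also have "\<dots> \<le> (\<Sum>i\<in>cell n m j. - (\<epsilon>\<^sup>2 / (32 * \<sigma>\<^sup>2)))"
      proof (rule sum_mono)
        fix i assume "i \<in> cell n m j"
        then have "\<epsilon> / 2 \<le> s * dev a i" using a by (auto simp: sign_region_def)
        then have "\<tau> * (\<epsilon> / 2) \<le> \<tau> * (s * dev a i)"
          using \<epsilon> by (intro mult_left_mono) (auto simp: \<tau>_def)
        moreover have "- (\<tau> * (\<epsilon> / 2)) + \<sigma>\<^sup>2 * \<tau>\<^sup>2 / 2 + \<tau> * \<epsilon> / 4 = - (\<epsilon>\<^sup>2 / (32 * \<sigma>\<^sup>2))"
          using sigma_pos by (simp add: \<tau>_def field_simps power2_eq_square)
        ultimately show "- (\<tau> * (s * dev a i)) + \<sigma>\<^sup>2 * \<tau>\<^sup>2 / 2 + \<tau> * \<epsilon> / 4 \<le> - (\<epsilon>\<^sup>2 / (32 * \<sigma>\<^sup>2))"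
          by linarith
      qed
      finally show ?thesis by simp
    qed
    have fin: "finite {1..n}" "{1..n} \<subseteq> {1..}" by auto
    note bound = nn_integral_prior_exp_noise_le[OF fin sign_region_measurable meas le]
    show "Q j s \<in> borel_measurable P"
      unfolding Q_def[abs_def] by (rule bound(2))
    have "(\<integral>\<^sup>+\<omega>. Q j s \<omega> \<partial>P) \<le> ennreal (exp (- (real (card (cell n m j)) * \<epsilon>\<^sup>2 / (32 * \<sigma>\<^sup>2))))
        * emeasure \<mu>\<^sub>0 (?A j s)"
      unfolding Q_def by (rule bound(1))
    also have "\<dots> \<le> ennreal E * 1"
      using card_le[OF j] by (intro mult_mono ennreal_leI prior.emeasure_le_1) auto
    finally show "(\<integral>\<^sup>+\<omega>. Q j s \<omega> \<partial>P) \<le> ennreal E" by simp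
  qed
  have Y: "(\<integral>\<^sup>+\<omega>. Y \<omega> \<partial>P) \<le> ennreal (V * p)" "Y \<in> borel_measurable P"
  proof -
    have le: "(\<Sum>i=1..n. \<sigma>\<^sup>2 * (- dev a i / \<sigma>\<^sup>2)\<^sup>2 / 2 + (dev a i)\<^sup>2 / (2 * \<sigma>\<^sup>2)) \<le> real n * \<delta>\<^sup>2 / \<sigma>\<^sup>2"
      if a: "a \<in> ?B" for a
    proof -
      have "(\<Sum>i=1..n. \<sigma>\<^sup>2 * (- dev a i / \<sigma>\<^sup>2)\<^sup>2 / 2 + (dev a i)\<^sup>2 / (2 * \<sigma>\<^sup>2)) \<le> (\<Sum>i=1..n. \<delta>\<^sup>2 / \<sigma>\<^sup>2)"
      proof (rule sum_mono)
        fix i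
        have "\<bar>dev a i\<bar> \<le> \<delta>"
          using dist_bounded[of a "x i" a\<^sub>0] a by (simp add: dev_def dist_real_def dist_commute)
        then have "(dev a i)\<^sup>2 \<le> \<delta>\<^sup>2" using \<delta> by (simp add: abs_le_square_iff[symmetric])
        moreover have "\<sigma>\<^sup>2 * (- dev a i / \<sigma>\<^sup>2)\<^sup>2 / 2 + (dev a i)\<^sup>2 / (2 * \<sigma>\<^sup>2) = (dev a i)\<^sup>2 / \<sigma>\<^sup>2"
          using sigma_pos by (simp add: field_simps power2_eq_square)
        ultimately show "\<sigma>\<^sup>2 * (- dev a i / \<sigma>\<^sup>2)\<^sup>2 / 2 + (dev a i)\<^sup>2 / (2 * \<sigma>\<^sup>2) \<le> \<delta>\<^sup>2 / \<sigma>\<^sup>2"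
          by (simp add: divide_right_mono)
      qed
      then show ?thesis by simp
    qed
    have fin: "finite {1..n}" "{1..n} \<subseteq> {1..}" by auto
    have meas: "(\<lambda>a. - dev a i / \<sigma>\<^sup>2) \<in> borel_measurable borel"
      "(\<lambda>a. (dev a i)\<^sup>2 / (2 * \<sigma>\<^sup>2)) \<in> borel_measurable borel" for i
      by measurable
    note bound = nn_integral_prior_exp_noise_le[OF fin B meas le]
    show "Y \<in> borel_measurable P"
      unfolding Y_def[abs_def] by (rule bound(2))
    show "(\<integral>\<^sup>+\<omega>. Y \<omega> \<partial>P) \<le> ennreal (V * p)"
      unfolding Y_def using bound(1) p V_pos
      by (simp add: V_def p_def prior.emeasure_eq_measure ennreal_mult)
  qed
  have Z_meas[measurable]: "Z \<in> borel_measurable P"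
    unfolding Z_def[abs_def] using Q(2) Y(2)
    by (intro borel_measurable_add borel_measurable_sum borel_measurable_times) auto
  have EZ: "(\<integral>\<^sup>+\<omega>. Z \<omega> \<partial>P) \<le> ennreal (2 * real m * E * (1 + g) + 1 / real n)"
  proof -
    have "(\<integral>\<^sup>+\<omega>. Z \<omega> \<partial>P) = (\<Sum>j<m. \<Sum>s\<in>?S. (\<integral>\<^sup>+\<omega>. T j s \<omega> \<partial>P) + ennreal g * (\<integral>\<^sup>+\<omega>. Q j s \<omega> \<partial>P))
        + ennreal (1 / (real n * p * V)) * (\<integral>\<^sup>+\<omega>. Y \<omega> \<partial>P)"
    proof -
      have inner: "(\<integral>\<^sup>+\<omega>. (\<Sum>s\<in>?S. T j s \<omega> + ennreal g * Q j s \<omega>) \<partial>P)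
          = (\<Sum>s\<in>?S. (\<integral>\<^sup>+\<omega>. T j s \<omega> \<partial>P) + ennreal g * (\<integral>\<^sup>+\<omega>. Q j s \<omega> \<partial>P))" if "j < m" for j
      proof -
        have [measurable]: "Q j s \<in> borel_measurable P" if "s \<in> ?S" for s
          using Q(2) \<open>j < m\<close> that by blast
        have "(\<integral>\<^sup>+\<omega>. (\<Sum>s\<in>?S. T j s \<omega> + ennreal g * Q j s \<omega>) \<partial>P)
            = (\<Sum>s\<in>?S. \<integral>\<^sup>+\<omega>. T j s \<omega> + ennreal g * Q j s \<omega> \<partial>P)"
          by (rule nn_integral_sum) measurable
        also have "\<dots> = (\<Sum>s\<in>?S. (\<integral>\<^sup>+\<omega>. T j s \<omega> \<partial>P) + ennreal g * (\<integral>\<^sup>+\<omega>. Q j s \<omega> \<partial>P))"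
          by (intro sum.cong refl) (simp add: nn_integral_add nn_integral_cmult)
        finally show ?thesis .
      qed
      have "(\<integral>\<^sup>+\<omega>. Z \<omega> \<partial>P) = (\<integral>\<^sup>+\<omega>. (\<Sum>j<m. \<Sum>s\<in>?S. T j s \<omega> + ennreal g * Q j s \<omega>) \<partial>P)
          + (\<integral>\<^sup>+\<omega>. ennreal (1 / (real n * p * V)) * Y \<omega> \<partial>P)"
        unfolding Z_def using Q(2) Y(2)
        by (intro nn_integral_add borel_measurable_sum borel_measurable_add borel_measurable_times) auto
      also have "(\<integral>\<^sup>+\<omega>. (\<Sum>j<m. \<Sum>s\<in>?S. T j s \<omega> + ennreal g * Q j s \<omega>) \<partial>P)
          = (\<Sum>j<m. \<integral>\<^sup>+\<omega>. (\<Sum>s\<in>?S. T j s \<omega> + ennreal g * Q j s \<omega>) \<partial>P)"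
        using Q(2) by (intro nn_integral_sum borel_measurable_sum borel_measurable_add borel_measurable_times) auto
      finally show ?thesis using inner nn_integral_cmult[OF Y(2)] by simp
    qed
    also have "\<dots> \<le> (\<Sum>j<m. \<Sum>s\<in>?S. ennreal E + ennreal g * ennreal E)
        + ennreal (1 / (real n * p * V)) * ennreal (V * p)"
      by (intro add_mono sum_mono mult_left_mono T_le Q(1) Y(1)) auto
    also have "\<dots> = ennreal (2 * real m * E * (1 + g) + 1 / real n)"
    proof -
      have "ennreal (1 / (real n * p * V)) * ennreal (V * p) = ennreal (1 / real n)"
        using p V_pos n by (simp add: ennreal_mult[symmetric])
      moreover have "(\<Sum>j<m. \<Sum>s\<in>?S. ennreal E + ennreal g * ennreal E) = ennreal (2 * real m * E * (1 + g))"
      proof -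
        have "ennreal E + ennreal g * ennreal E = ennreal (E * (1 + g))"
          using E_pos g_pos
          by (simp add: ennreal_mult[symmetric] ennreal_plus[symmetric] algebra_simps del: ennreal_plus)
        then have "(\<Sum>j<m. \<Sum>s\<in>?S. ennreal E + ennreal g * ennreal E)
            = ennreal (\<Sum>j<m. \<Sum>s\<in>?S. E * (1 + g))"
          using E_pos g_pos by (simp only: sum_ennreal sum_nonneg mult_nonneg_nonneg add_nonneg_nonneg
              less_imp_le zero_le_one)
        then show ?thesis by (simp add: algebra_simps)
      qed
      ultimately show ?thesis
        using E_pos g_pos by (simp add: ennreal_plus[symmetric] del: ennreal_plus)
    qed
    finally show ?thesis .
  qed

  have good: "measure (post n \<omega>) (ball a\<^sub>0 r) \<ge> 1 - 1 / real n" if Z1: "Z \<omega> < 1" for \<omega>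
  proof -
    have T1: "T j s \<omega> < 1" if "j < m" "s \<in> ?S" for j s
    proof -
      have "T j s \<omega> \<le> (\<Sum>s\<in>?S. T j s \<omega> + ennreal g * Q j s \<omega>)"
        by (rule order_trans[OF _ member_le_sum[OF that(2)]]) auto
      also have "\<dots> \<le> (\<Sum>j<m. \<Sum>s\<in>?S. T j s \<omega> + ennreal g * Q j s \<omega>)"
        using that by (intro member_le_sum[of j]) auto
      also have "\<dots> \<le> Z \<omega>" by (simp add: Z_def)
      finally show ?thesis using Z1 by simp
    qed
    have Q1: "ennreal g * (\<Sum>j<m. \<Sum>s\<in>?S. Q j s \<omega>) \<le> 1"
    proof -
      have "ennreal g * (\<Sum>j<m. \<Sum>s\<in>?S. Q j s \<omega>) \<le> (\<Sum>j<m. \<Sum>s\<in>?S. T j s \<omega> + ennreal g * Q j s \<omega>)"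
        unfolding sum_distrib_left by (intro sum_mono) auto
      also have "\<dots> \<le> Z \<omega>" by (simp add: Z_def)
      finally show ?thesis using Z1 by simp
    qed
    have Y1: "Y \<omega> \<le> ennreal (p / (1 / (real n * V)))"
    proof -
      have k: "real n * p * V > 0" using n p V_pos by simp
      have "ennreal (1 / (real n * p * V)) * Y \<omega> \<le> Z \<omega>" by (simp add: Z_def)
      then have "ennreal (1 / (real n * p * V)) * Y \<omega> \<le> 1" using Z1 by simp
      then have "ennreal (real n * p * V) * (ennreal (1 / (real n * p * V)) * Y \<omega>) \<le> ennreal (real n * p * V) * 1"
        by (intro mult_left_mono) auto
      also have "ennreal (real n * p * V) * (ennreal (1 / (real n * p * V)) * Y \<omega>) = Y \<omega>"
        using k n p V_pos by (auto simp add: mult.assoc[symmetric] ennreal_mult[symmetric])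
      finally show ?thesis by (simp add: mult_ac)
    qed
    have evidence: "ennreal (1 / (real n * V) * p) \<le> (\<integral>\<^sup>+a. ennreal (lik_ratio n \<omega> a) \<partial>\<mu>\<^sub>0)"
    proof -
      have inv: "1 / lik_ratio n \<omega> a = exp (\<Sum>i=1..n. - dev a i / \<sigma>\<^sup>2 * \<xi> i \<omega> + (dev a i)\<^sup>2 / (2 * \<sigma>\<^sup>2))" for a
        unfolding lik_ratio_def inverse_eq_divide[symmetric] exp_minus[symmetric] sum_negf[symmetric]
        by simp
      \<comment> \<open>The AM-GM bound with \<open>c = 1 / (n * V)\<close>; its hypothesis is
        \<open>Y1\<close>.\<close>
      have "ennreal (1 / (real n * V) * p) \<le> (\<integral>\<^sup>+a. indicator ?B a * ennreal (lik_ratio n \<omega> a) \<partial>\<mu>\<^sub>0)"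
        using Y1 n p V_pos
        by (intro nn_integral_ge_of_inverse_le)
           (auto simp: Y_def inv lik_ratio_pos sets_prior p_def prior.emeasure_eq_measure)
      also have "\<dots> \<le> (\<integral>\<^sup>+a. ennreal (lik_ratio n \<omega> a) \<partial>\<mu>\<^sub>0)"
        by (intro nn_integral_mono) (auto simp: indicator_def)
      finally show ?thesis .
    qed
    \<comment> \<open>\<open>T j s \<omega> < 1\<close> means that the exponent of \<open>T\<close>
      is negative, so subtracting it increases the exponent of the likelihood ratio.\<close>
    have tilt: "ennreal (lik_ratio n \<omega> a) \<le> ennreal (exp (\<Sum>i=1..n. cQ j s a i * \<xi> i \<omega> + dQ j s a i))"
      if "j < m" "s \<in> ?S" for j s a
    proof -
      have "(\<Sum>i=1..n. cQ j s a i * \<xi> i \<omega> + dQ j s a i)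
          = (\<Sum>i=1..n. (dev a i / \<sigma>\<^sup>2 * \<xi> i \<omega> + - (dev a i)\<^sup>2 / (2 * \<sigma>\<^sup>2))
              - (if i \<in> cell n m j then \<tau> * s * \<xi> i \<omega> + - (\<tau> * \<epsilon> / 4) else 0))"
        by (intro sum.cong) (auto simp: cQ_def dQ_def algebra_simps)
      also have "\<dots> = (\<Sum>i=1..n. dev a i / \<sigma>\<^sup>2 * \<xi> i \<omega> + - (dev a i)\<^sup>2 / (2 * \<sigma>\<^sup>2))
          - (\<Sum>i\<in>cell n m j. \<tau> * s * \<xi> i \<omega> + - (\<tau> * \<epsilon> / 4))"
        unfolding sum_subtractf sum_cell ..
      also have "\<dots> \<ge> (\<Sum>i=1..n. dev a i / \<sigma>\<^sup>2 * \<xi> i \<omega> + - (dev a i)\<^sup>2 / (2 * \<sigma>\<^sup>2))"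
      proof -
        have "exp (\<Sum>i\<in>cell n m j. \<tau> * s * \<xi> i \<omega> + - (\<tau> * \<epsilon> / 4)) < 1"
          using T1[OF that] unfolding T_def by (simp only: ennreal_less_one_iff)
        then show ?thesis by (simp only: exp_less_one_iff)
      qed
      finally show ?thesis unfolding lik_ratio_def by (intro ennreal_leI) simp
    qed
    have num: "(\<integral>\<^sup>+a. indicator (- ball a\<^sub>0 r) a * ennreal (lik_ratio n \<omega> a) \<partial>\<mu>\<^sub>0)
        \<le> (\<Sum>j<m. \<Sum>s\<in>?S. Q j s \<omega>)"
    proof -
      have "(\<integral>\<^sup>+a. indicator (- ball a\<^sub>0 r) a * ennreal (lik_ratio n \<omega> a) \<partial>\<mu>\<^sub>0)
          \<le> (\<integral>\<^sup>+a. (\<Sum>j<m. \<Sum>s\<in>?S. indicator (?A j s) a *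
              ennreal (exp (\<Sum>i=1..n. cQ j s a i * \<xi> i \<omega> + dQ j s a i))) \<partial>\<mu>\<^sub>0)"
        (is "_ \<le> (\<integral>\<^sup>+a. (\<Sum>j<m. \<Sum>s\<in>?S. ?F j s a) \<partial>\<mu>\<^sub>0)")
      proof (rule nn_integral_mono_AE, use holder in eventually_elim)
        fix a assume h: "\<forall>s t. \<bar>(apply_bcontfun a s - apply_bcontfun a\<^sub>0 s)
          - (apply_bcontfun a t - apply_bcontfun a\<^sub>0 t)\<bar> \<le> \<Lambda> * dist s t powr \<beta>"
        show "indicator (- ball a\<^sub>0 r) a * ennreal (lik_ratio n \<omega> a) \<le> (\<Sum>j<m. \<Sum>s\<in>?S. ?F j s a)"
        proof (cases "a \<in> ball a\<^sub>0 r")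
          case False
          \<comment> \<open>Outside the open ball the norm is only known to be at least
            \<open>r\<close>; the gap \<open>\<epsilon> < r\<close> provides the strict
            inequality.\<close>
          then have "norm (a - a\<^sub>0) > \<epsilon>" using \<epsilon> by (simp add: dist_norm norm_minus_commute)
          then obtain j s where js: "j < m" "s \<in> ?S" "a \<in> ?A j s"
            using ex_sign_region[OF _ \<Lambda> \<beta> m mesh] h by blast
          have "indicator (- ball a\<^sub>0 r) a * ennreal (lik_ratio n \<omega> a) \<le> ?F j s a"
            using tilt[OF js(1,2)] js(3) False by simp
          also have "\<dots> \<le> (\<Sum>s\<in>?S. ?F j s a)"
            by (rule member_le_sum[OF js(2)]) auto
          also have "\<dots> \<le> (\<Sum>j<m. \<Sum>s\<in>?S. ?F j s a)"
            using js(1) by (intro member_le_sum[of j]) auto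
          finally show ?thesis .
        qed simp
      qed
      also have "\<dots> = (\<Sum>j<m. \<Sum>s\<in>?S. Q j s \<omega>)"
      proof -
        have F: "?F j s \<in> borel_measurable \<mu>\<^sub>0" for j s
          unfolding cQ_def dQ_def by measurable
        have "(\<integral>\<^sup>+a. (\<Sum>j<m. \<Sum>s\<in>?S. ?F j s a) \<partial>\<mu>\<^sub>0) = (\<Sum>j<m. \<integral>\<^sup>+a. (\<Sum>s\<in>?S. ?F j s a) \<partial>\<mu>\<^sub>0)"
          by (intro nn_integral_sum borel_measurable_sum F)
        also have "\<dots> = (\<Sum>j<m. \<Sum>s\<in>?S. Q j s \<omega>)"
          unfolding Q_def by (intro sum.cong refl nn_integral_sum F)
        finally show ?thesis .
      qed
      finally show ?thesis .
    qed
    have gn: "ennreal (1 / real n) * ennreal (1 / (real n * V) * p) = ennreal (1 / g)"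
      using n p V_pos by (simp add: ennreal_mult[symmetric] g_def power2_eq_square)
    show ?thesis
    proof (rule posterior_ge)
      have "(\<Sum>j<m. \<Sum>s\<in>?S. Q j s \<omega>) = ennreal (1 / g) * (ennreal g * (\<Sum>j<m. \<Sum>s\<in>?S. Q j s \<omega>))"
        using g_pos by (simp add: mult.assoc[symmetric] ennreal_mult[symmetric])
      also have "\<dots> \<le> ennreal (1 / g) * 1" by (intro mult_left_mono Q1) auto
      also have "\<dots> = ennreal (1 / real n) * ennreal (1 / (real n * V) * p)" using gn by simp
      also have "\<dots> \<le> ennreal (1 / real n) * (\<integral>\<^sup>+a. ennreal (lik_ratio n \<omega> a) \<partial>\<mu>\<^sub>0)"
        by (intro mult_left_mono evidence) auto
      finally show "(\<integral>\<^sup>+a. indicator (- ball a\<^sub>0 r) a * ennreal (lik_ratio n \<omega> a) \<partial>\<mu>\<^sub>0)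
          \<le> ennreal (1 / real n) * (\<integral>\<^sup>+a. ennreal (lik_ratio n \<omega> a) \<partial>\<mu>\<^sub>0)"
        using num by simp
    qed auto
  qed

  let ?good = "{\<omega> \<in> space P. measure (post n \<omega>) (ball a\<^sub>0 r) \<ge> 1 - 1 / real n}"
  have [measurable]: "(\<lambda>\<omega>. measure (post n \<omega>) (ball a\<^sub>0 r)) \<in> borel_measurable P"
    by (rule measure_posterior_measurable) simp
  have good_sets: "?good \<in> sets P" by measurable
  \<comment> \<open>By \<open>good\<close>, failure forces
    \<open>Z \<omega> \<ge> 1\<close>.\<close>
  have "emeasure P (space P - ?good) \<le> emeasure P {\<omega> \<in> space P. 1 \<le> 1 * Z \<omega>}"
    using good by (intro emeasure_mono) (auto simp: not_le[symmetric])
  also have "\<dots> \<le> 1 * (\<integral>\<^sup>+\<omega>. Z \<omega> * indicator (space P) \<omega> \<partial>P)"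
    by (rule nn_integral_Markov_inequality) auto
  also have "\<dots> = (\<integral>\<^sup>+\<omega>. Z \<omega> \<partial>P)"
    by (auto intro!: nn_integral_cong)
  also have "\<dots> \<le> ennreal (2 * real m * E * (1 + g) + 1 / real n)" by (rule EZ)
  finally have "measure P (space P - ?good) \<le> 2 * real m * E * (1 + g) + 1 / real n"
    using E_pos g_pos by (simp add: noise.emeasure_eq_measure ennreal_plus[symmetric] del: ennreal_plus)
  then show ?thesis
    using noise.prob_compl[OF good_sets] by (simp add: E_def g_def V_def)
qed

section \<open>From finite samples to concentration along a sequence\<close>

text \<open>The finite-sample bound with level \<open>l n = 1 - 1 / n\<close>. The radius
  \<open>\<delta> n\<close> remains free: shrinking it lowers
  \<open>exp (n * \<delta>\<^sup>2 / \<sigma>\<^sup>2)\<close> but also the prior mass in the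
  denominator.\<close>

lemma posterior_concentratesI:
  fixes N \<epsilon> \<delta> r b :: "nat \<Rightarrow> real" and m :: "nat \<Rightarrow> nat"
  assumes holder: "AE a in \<mu>\<^sub>0. \<forall>s t. \<bar>(apply_bcontfun a s - apply_bcontfun a\<^sub>0 s)
        - (apply_bcontfun a t - apply_bcontfun a\<^sub>0 t)\<bar> \<le> \<Lambda> * dist s t powr \<beta>"
    and \<Lambda>: "\<Lambda> > 0" and \<beta>: "\<beta> > 0"
    and m: "\<And>n. (2 * \<Lambda> / \<epsilon> n) powr (1 / \<beta>) \<le> real (m n)"
    and \<epsilon>: "\<forall>\<^sub>F n in sequentially. 0 < \<epsilon> n \<and> \<epsilon> n < r n"
    and \<delta>: "\<forall>\<^sub>F n in sequentially. 0 < \<delta> n \<and> 0 < measure \<mu>\<^sub>0 (ball a\<^sub>0 (\<delta> n))"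
    and N: "\<forall>\<^sub>F n in sequentially. \<forall>j<m n. N n \<le> real (card (cell n (m n) j))"
    and b: "\<forall>\<^sub>F n in sequentially. real (m n) * exp (- (N n * (\<epsilon> n)\<^sup>2 / (32 * \<sigma>\<^sup>2)))
        * (1 + (real n)\<^sup>2 * exp (real n * (\<delta> n)\<^sup>2 / \<sigma>\<^sup>2) / measure \<mu>\<^sub>0 (ball a\<^sub>0 (\<delta> n))) \<le> b n"
    and lim: "b \<longlonglongrightarrow> 0"
  shows "posterior_concentrates \<mu>\<^sub>0 x \<sigma> P \<xi> a\<^sub>0 r"
proof -
  let ?prob = "\<lambda>n. measure P {\<omega> \<in> space P. measure (post n \<omega>) (ball a\<^sub>0 (r n)) \<ge> 1 - 1 / real n}"
  have low: "(\<lambda>n. 1 - (1 / real n + 2 * b n)) \<longlonglongrightarrow> 1"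
    using tendsto_diff[OF tendsto_const[of 1] tendsto_add[OF lim_1_over_n tendsto_mult[OF tendsto_const[of 2] lim]]]
    by simp
  have "\<forall>\<^sub>F n in sequentially. 1 - (1 / real n + 2 * b n) \<le> ?prob n"
    using \<epsilon> \<delta> N b eventually_ge_at_top[of 1]
  proof eventually_elim
    case (elim n)
    have mesh: "m n \<ge> 1" "\<Lambda> * (1 / real (m n)) powr \<beta> \<le> \<epsilon> n / 2"
      using holder_mesh[OF \<Lambda> \<beta> _ m[of n]] elim by auto
    show ?case
      using posterior_ball_finite_sample[OF holder less_imp_le[OF \<Lambda>] \<beta> mesh(1) _ _ _ _ refl _ mesh(2),
          of n "r n" "\<delta> n" "N n"] elim
      by (simp add: mult.assoc)
  qed
  then have "?prob \<longlonglongrightarrow> 1"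
    by (rule tendsto_sandwich[OF _ _ low tendsto_const]) simp
  moreover have "(\<lambda>n. 1 - 1 / real n) \<longlonglongrightarrow> 1"
    using tendsto_diff[OF tendsto_const[of 1] lim_1_over_n] by simp
  ultimately show ?thesis unfolding posterior_concentrates_def by blast
qed

end

section \<open>Choice of the parameters for consistency and for the rate\<close>

theorem theorem3p7:
  fixes \<mu>\<^sub>0 :: "C01 measure"
    and x :: "nat \<Rightarrow> unit_interval"
    and \<sigma> \<beta> L :: real
    and P :: "'w measure"
    and \<xi> :: "nat \<Rightarrow> 'w \<Rightarrow> real"
  assumes prior: "prob_space \<mu>\<^sub>0" "sets \<mu>\<^sub>0 = sets borel"
    and sigma: "\<sigma> > 0"
    and noise: "iid_gaussian_noise P \<xi> \<sigma>"
    and beta: "0 < \<beta>" "\<beta> \<le> 1"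
    and L: "L > 0"
    and i: "AE a in \<mu>\<^sub>0. holder_seminorm \<beta> a \<le> ennreal L \<and> norm a \<le> L"
    and ii: "\<exists>K>0. \<forall>a b. 0 \<le> a \<and> a < b \<and> b \<le> 1 \<longrightarrow>
               (\<exists>N. \<forall>n>N. empirical_cdf x n b - empirical_cdf x n a \<ge> K * (b - a))"
  shows "\<forall>a\<^sub>0 \<in> holder_support \<beta> \<mu>\<^sub>0.
           posterior_consistent \<mu>\<^sub>0 x \<sigma> P \<xi> a\<^sub>0 \<and>
           (\<forall>\<rho>>0.
              (\<exists>K>0. \<forall>n\<ge>1. \<forall>a b. 0 < a \<and> a < b \<and> b < 1 \<and> b - a \<ge> 1 / (K * real n) \<longrightarrow>
                 (\<exists>i\<in>{1..n}. a < of_unit (x i) \<and> of_unit (x i) < b)) \<longrightarrow>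
              small_ball_condition \<mu>\<^sub>0 a\<^sub>0 \<rho> \<longrightarrow>
              (\<forall>\<kappa> < min (1 / (2 * (2 + 1 / \<beta>))) (2 * \<beta> / ((2 * \<beta> + 1) * (2 + \<rho>))).
                 posterior_consistent_with_rate \<mu>\<^sub>0 x \<sigma> P \<xi> a\<^sub>0 (\<lambda>n. real n powr (-\<kappa>))))"
proof (intro ballI)
  fix a\<^sub>0 assume a0: "a\<^sub>0 \<in> holder_support \<beta> \<mu>\<^sub>0"
  have "prob_space P" using noise by (simp add: iid_gaussian_noise_def)
  then interpret gaussian_regression \<mu>\<^sub>0 P x \<sigma> \<xi> a\<^sub>0
    using prior sigma noise
    by (intro gaussian_regression.intro gaussian_regression_axioms.intro)
       (auto simp: iid_gaussian_noise_def)
  \<comment> \<open>Membership in the support puts \<open>a\<^sub>0\<close> in the Hoelder space, so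
    its seminorm is finite and \<open>enn2real\<close> returns its true value. Adding the two
    constants gives one for \<open>a - a\<^sub>0\<close>.\<close>
  define L\<^sub>0 where "L\<^sub>0 = enn2real (holder_seminorm \<beta> a\<^sub>0)"
  define \<Lambda> where "\<Lambda> = L + L\<^sub>0"
  have L0: "L\<^sub>0 \<ge> 0" "holder_seminorm \<beta> a\<^sub>0 \<le> ennreal L\<^sub>0"
    using a0 by (simp_all add: L\<^sub>0_def holder_support_def metric_support_def holder_space_def)
  have \<Lambda>: "\<Lambda> > 0" using L L0 by (simp add: \<Lambda>_def)
  have holder: "AE a in \<mu>\<^sub>0. \<forall>s t. \<bar>(apply_bcontfun a s - apply_bcontfun a\<^sub>0 s)
        - (apply_bcontfun a t - apply_bcontfun a\<^sub>0 t)\<bar> \<le> \<Lambda> * dist s t powr \<beta>"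
    using i
  proof (eventually_elim, intro allI)
    fix a s t assume "holder_seminorm \<beta> a \<le> ennreal L \<and> norm a \<le> L"
    then have "\<bar>apply_bcontfun a s - apply_bcontfun a t\<bar> \<le> L * dist s t powr \<beta>"
      using L by (intro holder_seminorm_leD) auto
    moreover have "\<bar>apply_bcontfun a\<^sub>0 s - apply_bcontfun a\<^sub>0 t\<bar> \<le> L\<^sub>0 * dist s t powr \<beta>"
      using L0 by (intro holder_seminorm_leD) auto
    ultimately show "\<bar>(apply_bcontfun a s - apply_bcontfun a\<^sub>0 s)
        - (apply_bcontfun a t - apply_bcontfun a\<^sub>0 t)\<bar> \<le> \<Lambda> * dist s t powr \<beta>"
      unfolding \<Lambda>_def distrib_right by linarith
  qed
  show "posterior_consistent \<mu>\<^sub>0 x \<sigma> P \<xi> a\<^sub>0 \<and>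
     (\<forall>\<rho>>0.
        (\<exists>K>0. \<forall>n\<ge>1. \<forall>a b. 0 < a \<and> a < b \<and> b < 1 \<and> b - a \<ge> 1 / (K * real n) \<longrightarrow>
           (\<exists>i\<in>{1..n}. a < of_unit (x i) \<and> of_unit (x i) < b)) \<longrightarrow>
        small_ball_condition \<mu>\<^sub>0 a\<^sub>0 \<rho> \<longrightarrow>
        (\<forall>\<kappa> < min (1 / (2 * (2 + 1 / \<beta>))) (2 * \<beta> / ((2 * \<beta> + 1) * (2 + \<rho>))).
           posterior_consistent_with_rate \<mu>\<^sub>0 x \<sigma> P \<xi> a\<^sub>0 (\<lambda>n. real n powr (-\<kappa>))))"
  proof (intro conjI allI impI)
    show "posterior_consistent \<mu>\<^sub>0 x \<sigma> P \<xi> a\<^sub>0"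
      unfolding posterior_consistent_def
    proof (intro allI impI)
      fix \<epsilon> :: real assume \<epsilon>: "\<epsilon> > 0"
      obtain K where K: "K > 0" "\<forall>a b. 0 \<le> a \<and> a < b \<and> b \<le> 1 \<longrightarrow>
          (\<exists>N. \<forall>n>N. empirical_cdf x n b - empirical_cdf x n a \<ge> K * (b - a))"
        using ii by blast
      \<comment> \<open>The mesh is built for level \<open>\<epsilon> / 2\<close>, which leaves a
        gap below the radius \<open>\<epsilon>\<close>. It does not depend on \<open>n\<close>, so
        (ii) controls all its cells at once.\<close>
      define m where "m = nat \<lceil>(2 * \<Lambda> / (\<epsilon> / 2)) powr (1 / \<beta>)\<rceil>"
      have m: "(2 * \<Lambda> / (\<epsilon> / 2)) powr (1 / \<beta>) \<le> real m"
        unfolding m_def by (rule real_nat_ceiling_ge)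
      have m1: "m \<ge> 1" using holder_mesh(1)[OF \<Lambda> beta(1) _ m] \<epsilon> by simp
      \<comment> \<open>The test exponent per observation, with \<open>K * n / m\<close> design
        points in each cell.\<close>
      define c where "c = K * (\<epsilon> / 2)\<^sup>2 / (32 * \<sigma>\<^sup>2 * real m)"
      have c: "c > 0" using K \<epsilon> sigma m1 by (simp add: c_def)
      \<comment> \<open>Chosen so that the evidence costs \<open>c / 2 * n\<close> in the exponent,
        half of what the tests gain.\<close>
      define \<delta> where "\<delta> = sqrt (c * \<sigma>\<^sup>2 / 2)"
      have \<delta>: "\<delta> > 0" "\<delta>\<^sup>2 = c * \<sigma>\<^sup>2 / 2" using c sigma by (simp_all add: \<delta>_def)
      have p: "measure \<mu>\<^sub>0 (ball a\<^sub>0 \<delta>) > 0"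
        by (rule measure_ball_pos_of_holder_support[OF a0 prior \<delta>(1)])
      have lim: "(\<lambda>n. real m * exp (- (c * real n))
          * (1 + (real n)\<^sup>2 * exp (c / 2 * real n) / measure \<mu>\<^sub>0 (ball a\<^sub>0 \<delta>))) \<longlonglongrightarrow> 0"
        using c p by real_asymp
      show "posterior_concentrates \<mu>\<^sub>0 x \<sigma> P \<xi> a\<^sub>0 (\<lambda>n. \<epsilon>)"
      proof (rule posterior_concentratesI[OF holder \<Lambda> beta(1) m _ _ eventually_card_design_cell_ge[OF K(2) m1] _ lim])
        have "K * real n / real m * (\<epsilon> / 2)\<^sup>2 / (32 * \<sigma>\<^sup>2) = c * real n" for n
          by (simp add: c_def field_simps)
        moreover have "real n * \<delta>\<^sup>2 / \<sigma>\<^sup>2 = c / 2 * real n" for n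
          using sigma by (simp add: \<delta>(2))
        ultimately have "real m * exp (- (K * real n / real m * (\<epsilon> / 2)\<^sup>2 / (32 * \<sigma>\<^sup>2)))
            * (1 + (real n)\<^sup>2 * exp (real n * \<delta>\<^sup>2 / \<sigma>\<^sup>2) / measure \<mu>\<^sub>0 (ball a\<^sub>0 \<delta>))
          = real m * exp (- (c * real n))
            * (1 + (real n)\<^sup>2 * exp (c / 2 * real n) / measure \<mu>\<^sub>0 (ball a\<^sub>0 \<delta>))" for n
          by (simp only:)
        then show "\<forall>\<^sub>F n in sequentially. real m * exp (- (K * real n / real m * (\<epsilon> / 2)\<^sup>2 / (32 * \<sigma>\<^sup>2)))
            * (1 + (real n)\<^sup>2 * exp (real n * \<delta>\<^sup>2 / \<sigma>\<^sup>2) / measure \<mu>\<^sub>0 (ball a\<^sub>0 \<delta>))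
          \<le> real m * exp (- (c * real n))
            * (1 + (real n)\<^sup>2 * exp (c / 2 * real n) / measure \<mu>\<^sub>0 (ball a\<^sub>0 \<delta>))"
          by (simp only: order_refl eventually_True)
      qed (use \<epsilon> \<delta> p in auto)
    qed
  next
    fix \<rho> \<kappa> :: real
    assume \<rho>: "\<rho> > 0"
      and iii: "\<exists>K>0. \<forall>n\<ge>1. \<forall>a b. 0 < a \<and> a < b \<and> b < 1 \<and> b - a \<ge> 1 / (K * real n) \<longrightarrow>
           (\<exists>i\<in>{1..n}. a < of_unit (x i) \<and> of_unit (x i) < b)"
      and iv: "small_ball_condition \<mu>\<^sub>0 a\<^sub>0 \<rho>"
      and \<kappa>: "\<kappa> < min (1 / (2 * (2 + 1 / \<beta>))) (2 * \<beta> / ((2 * \<beta> + 1) * (2 + \<rho>)))"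
    obtain K where K: "K > 0" and dense: "\<And>n a b. n \<ge> 1 \<Longrightarrow> 0 < a \<Longrightarrow> a < b \<Longrightarrow> b < 1 \<Longrightarrow>
        b - a \<ge> 1 / (K * real n) \<Longrightarrow> \<exists>i\<in>{1..n}. a < of_unit (x i) \<and> of_unit (x i) < b"
      using iii by blast
    obtain B \<epsilon>\<^sub>0 where B: "B > 0" and \<epsilon>\<^sub>0: "\<epsilon>\<^sub>0 > 0" and small: "\<And>\<epsilon>. 0 < \<epsilon> \<Longrightarrow> \<epsilon> \<le> \<epsilon>\<^sub>0 \<Longrightarrow>
        measure \<mu>\<^sub>0 (ball a\<^sub>0 \<epsilon>) > 0 \<and> ln (measure \<mu>\<^sub>0 (ball a\<^sub>0 \<epsilon>)) \<ge> - B * \<epsilon> powr (-\<rho>)"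
      using iv unfolding small_ball_condition_def by blast
    \<comment> \<open>The maximum with 0 makes \<open>k\<close> positive even if
      \<open>\<kappa>\<close> is not. Strictness on both sides leaves room to absorb constants and
      to separate the two exponents below.\<close>
    have "max \<kappa> 0 < 2 * \<beta> / ((2 * \<beta> + 1) * (2 + \<rho>))" using \<kappa> beta \<rho> by simp
    then obtain k where k: "max \<kappa> 0 < k" "k < 2 * \<beta> / ((2 * \<beta> + 1) * (2 + \<rho>))"
      using Orderings.dense[of "max \<kappa> 0"] by blast
    \<comment> \<open>\<open>n powr \<theta>\<^sub>0\<close> is the order of the log evidence and
      \<open>n powr \<theta>\<^sub>1\<close> that of the number of points per cell times the squared
      level. The upper bound on \<open>k\<close> is the inequality
      \<open>\<theta>\<^sub>0 < \<theta>\<^sub>1\<close> solved for \<open>k\<close>.\<close>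
    define \<theta>\<^sub>0 where "\<theta>\<^sub>0 = \<rho> / (2 + \<rho>)"
    define \<theta>\<^sub>1 where "\<theta>\<^sub>1 = 1 - k / \<beta> - 2 * k"
    have \<theta>\<^sub>0: "\<theta>\<^sub>0 > 0" using \<rho> by (simp add: \<theta>\<^sub>0_def)
    have \<theta>\<^sub>1: "\<theta>\<^sub>0 < \<theta>\<^sub>1"
    proof -
      have "k * ((2 * \<beta> + 1) * (2 + \<rho>)) < 2 * \<beta>"
        using k(2) beta \<rho> by (simp add: pos_less_divide_eq)
      then have "k * (2 * \<beta> + 1) / \<beta> < 2 / (2 + \<rho>)"
        using beta \<rho> by (simp add: field_simps)
      moreover have "k * (2 * \<beta> + 1) / \<beta> = k / \<beta> + 2 * k" "2 / (2 + \<rho>) = 1 - \<theta>\<^sub>0"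
        using beta \<rho> by (simp_all add: \<theta>\<^sub>0_def field_simps)
      ultimately show ?thesis by (simp add: \<theta>\<^sub>1_def)
    qed
    define \<epsilon> where "\<epsilon> n = real n powr (-k)" for n :: nat
    \<comment> \<open>Balances \<open>n * \<delta>\<^sup>2\<close> against the small-ball exponent
      \<open>\<delta> powr (-\<rho>)\<close>; both equal
      \<open>n powr \<theta>\<^sub>0\<close>.\<close>
    define \<delta> where "\<delta> n = real n powr (- 1 / (2 + \<rho>))" for n :: nat
    define m where "m n = nat \<lceil>(2 * \<Lambda> / \<epsilon> n) powr (1 / \<beta>)\<rceil>" for n
    \<comment> \<open>The added 1 pays for the ceiling in \<open>m n\<close>.\<close>
    define D where "D = (2 * \<Lambda>) powr (1 / \<beta>) + 1"
    \<comment> \<open>One factor 2 comes from hitting only middle halves of subintervals, the other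
      from rounding their number down.\<close>
    define N where "N n = K * real n / (4 * real (m n))" for n
    \<comment> \<open>The constant 128 is the 4 from \<open>N\<close> times the 32 from the test
      exponent.\<close>
    define c where "c = K / (128 * \<sigma>\<^sup>2 * D)"
    define A where "A = 1 / \<sigma>\<^sup>2 + B"
    define b where "b n = D * real n powr (k / \<beta>) * exp (- (c * real n powr \<theta>\<^sub>1))
        * (1 + (real n)\<^sup>2 * exp (A * real n powr \<theta>\<^sub>0))" for n :: nat
    have D: "D > 0" using \<Lambda> by (simp add: D_def add_pos_pos)
    have c: "c > 0" using K D sigma by (simp add: c_def)
    have A: "A > 0" using B sigma by (simp add: A_def add_pos_pos)
    have k0: "k > 0" "\<kappa> < k" using k by auto
    have m_ge: "(2 * \<Lambda> / \<epsilon> n) powr (1 / \<beta>) \<le> real (m n)" for n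
      unfolding m_def by (rule real_nat_ceiling_ge)
    have \<epsilon>_pos: "\<epsilon> n > 0" and \<delta>_pos: "\<delta> n > 0" if "n \<ge> 1" for n
      using that by (simp_all add: \<epsilon>_def \<delta>_def)
    have m1: "m n \<ge> 1" if "n \<ge> 1" for n
      using holder_mesh(1)[OF \<Lambda> beta(1) \<epsilon>_pos[OF that] m_ge] .
    have m_le: "real (m n) \<le> D * real n powr (k / \<beta>)" if n: "n \<ge> 1" for n
    proof -
      have "(2 * \<Lambda> / \<epsilon> n) powr (1 / \<beta>) = (2 * \<Lambda>) powr (1 / \<beta>) * real n powr (k / \<beta>)"
        using \<Lambda> n by (simp add: \<epsilon>_def powr_minus divide_inverse powr_mult powr_powr)
      moreover have "real (m n) \<le> (2 * \<Lambda> / \<epsilon> n) powr (1 / \<beta>) + 1"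
        unfolding m_def using of_int_ceiling_le_add_one by (simp add: of_nat_nat)
      moreover have "1 \<le> real n powr (k / \<beta>)"
        using n k0 beta by (intro ge_one_powr_ge_zero) auto
      ultimately show ?thesis by (simp add: D_def algebra_simps)
    qed
    have lim: "b \<longlonglongrightarrow> 0"
      unfolding b_def using A D c k0 beta \<theta>\<^sub>0 \<theta>\<^sub>1 by (intro exp_power_gap_tendsto_0) auto
    have \<delta>_small: "\<forall>\<^sub>F n in sequentially. n \<ge> 1 \<and> \<delta> n \<le> \<epsilon>\<^sub>0"
    proof -
      have "\<delta> \<longlonglongrightarrow> 0" unfolding \<delta>_def using \<rho> by real_asymp
      then have "\<forall>\<^sub>F n in sequentially. \<delta> n < \<epsilon>\<^sub>0" using \<epsilon>\<^sub>0 by (rule order_tendstoD)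
      with eventually_ge_at_top[of 1] show ?thesis by eventually_elim auto
    qed
    have "posterior_concentrates \<mu>\<^sub>0 x \<sigma> P \<xi> a\<^sub>0 (\<lambda>n. real n powr (-\<kappa>))"
    proof (rule posterior_concentratesI[OF holder \<Lambda> beta(1) m_ge _ _ _ _ lim])
      show "\<forall>\<^sub>F n in sequentially. 0 < \<epsilon> n \<and> \<epsilon> n < real n powr (-\<kappa>)"
        using eventually_gt_at_top[of 1]
        by eventually_elim (use k0 in \<open>auto simp: \<epsilon>_def\<close>)
      show "\<forall>\<^sub>F n in sequentially. 0 < \<delta> n \<and> 0 < measure \<mu>\<^sub>0 (ball a\<^sub>0 (\<delta> n))"
        using \<delta>_small by eventually_elim (use \<delta>_pos small in auto)
      show "\<forall>\<^sub>F n in sequentially. \<forall>j<m n. N n \<le> real (card (cell n (m n) j))"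
      proof -
        \<comment> \<open>The number of cells, of order at most \<open>n powr (k / \<beta>)\<close>,
          then grows more slowly than \<open>n\<close>, so eventually every cell can be
          subdivided.\<close>
        have "k / \<beta> < 1" using \<theta>\<^sub>0 \<theta>\<^sub>1 k0 by (simp add: \<theta>\<^sub>1_def)
        then have "\<forall>\<^sub>F n in sequentially. 2 * D * real n powr (k / \<beta>) \<le> K * real n"
          using K D k0 beta by real_asymp
        with eventually_ge_at_top[of 1] show ?thesis
        proof (eventually_elim, intro allI impI)
          fix n j assume n: "n \<ge> (1::nat)" and le: "2 * D * real n powr (k / \<beta>) \<le> K * real n" and j: "j < m n"
          \<comment> \<open>The largest number of subintervals that the design condition permits,
            before rounding. From \<open>y \<ge> 1\<close>, rounding down costs at most
            half.\<close>
          define y where "y = K * real n / (2 * real (m n))"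
          have y: "y \<ge> 1" using le m_le[OF n] m1[OF n] by (simp add: y_def)
          have "\<lfloor>y\<rfloor> \<ge> 1" using y by simp
          then have fl: "real (nat \<lfloor>y\<rfloor>) \<le> y" "y / 2 \<le> real (nat \<lfloor>y\<rfloor>)" by linarith+
          have "2 * real (m n) * real (nat \<lfloor>y\<rfloor>) \<le> K * real n"
            using fl(1) m1[OF n] by (simp add: y_def field_simps)
          then have "nat \<lfloor>y\<rfloor> \<le> card (cell n (m n) j)"
            using dense[OF n] by (intro card_design_cell_ge_of_dense[OF _ K n j]) auto
          moreover have "N n = y / 2" by (simp add: N_def y_def)
          ultimately show "N n \<le> real (card (cell n (m n) j))" using fl(2) by linarith
        qed
      qed
      show "\<forall>\<^sub>F n in sequentially. real (m n) * exp (- (N n * (\<epsilon> n)\<^sup>2 / (32 * \<sigma>\<^sup>2)))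
          * (1 + (real n)\<^sup>2 * exp (real n * (\<delta> n)\<^sup>2 / \<sigma>\<^sup>2) / measure \<mu>\<^sub>0 (ball a\<^sub>0 (\<delta> n))) \<le> b n"
        using \<delta>_small
      proof eventually_elim
        case (elim n)
        then have n: "n \<ge> 1" by simp
        let ?p = "measure \<mu>\<^sub>0 (ball a\<^sub>0 (\<delta> n))"
        have test: "c * real n powr \<theta>\<^sub>1 \<le> N n * (\<epsilon> n)\<^sup>2 / (32 * \<sigma>\<^sup>2)"
        proof -
          have "real n powr \<theta>\<^sub>1 = real n / real n powr (k / \<beta>) * (\<epsilon> n)\<^sup>2"
            using n by (simp add: \<theta>\<^sub>1_def \<epsilon>_def powr_diff powr_minus powr_add field_simps powr_power)
          then have "c * real n powr \<theta>\<^sub>1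
              = K * real n / (4 * (D * real n powr (k / \<beta>))) * (\<epsilon> n)\<^sup>2 / (32 * \<sigma>\<^sup>2)"
            by (simp add: c_def mult_ac)
          also have "\<dots> \<le> N n * (\<epsilon> n)\<^sup>2 / (32 * \<sigma>\<^sup>2)"
            unfolding N_def using m_le[OF n] m1[OF n] K D n
            by (intro divide_right_mono mult_right_mono divide_left_mono mult_pos_pos) auto
          finally show ?thesis .
        qed
        have "real n * (\<delta> n)\<^sup>2 = real n powr \<theta>\<^sub>0"
        proof -
          have "real n * (\<delta> n)\<^sup>2 = real n powr (1 + 2 * (- 1 / (2 + \<rho>)))"
            using n by (simp only: powr_add) (simp add: \<delta>_def powr_power mult.commute)
          also have "1 + 2 * (- 1 / (2 + \<rho>)) = \<theta>\<^sub>0" using \<rho> by (simp add: \<theta>\<^sub>0_def field_simps)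
          finally show ?thesis .
        qed
        moreover have "\<delta> n powr (-\<rho>) = real n powr \<theta>\<^sub>0"
          by (simp add: \<delta>_def \<theta>\<^sub>0_def powr_powr)
        moreover have p: "?p > 0" "ln ?p \<ge> - B * \<delta> n powr (-\<rho>)"
          using small[OF \<delta>_pos[OF n]] elim by auto
        ultimately have "real n * (\<delta> n)\<^sup>2 / \<sigma>\<^sup>2 - ln ?p \<le> A * real n powr \<theta>\<^sub>0"
          by (simp add: A_def distrib_right)
        moreover have "exp (real n * (\<delta> n)\<^sup>2 / \<sigma>\<^sup>2) / ?p = exp (real n * (\<delta> n)\<^sup>2 / \<sigma>\<^sup>2 - ln ?p)"
          using p(1) by (simp add: exp_diff)
        ultimately have mass: "exp (real n * (\<delta> n)\<^sup>2 / \<sigma>\<^sup>2) / ?p \<le> exp (A * real n powr \<theta>\<^sub>0)"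
          by simp
        show ?case
          unfolding b_def times_divide_eq_right[symmetric]
          using m_le[OF n] test mass p(1) D
          by (intro mult_mono add_mono order_refl mult_left_mono) (auto intro!: add_nonneg_nonneg mult_nonneg_nonneg)
      qed
    qed
    \<comment> \<open>The constant \<open>M = 1\<close> suffices, because
      \<open>\<kappa> < k\<close> already leaves a gap between level and radius.\<close>
    then show "posterior_consistent_with_rate \<mu>\<^sub>0 x \<sigma> P \<xi> a\<^sub>0 (\<lambda>n. real n powr (-\<kappa>))"
      unfolding posterior_consistent_with_rate_def by (intro exI[of _ 1]) simp
  qed
qed

end
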